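(* Let $1 \leq a \leq b \leq c$ be integers with $(a,b) \neq (1,2)$, and suppose $c \geq d = \max(4,ab)$. Then $\left|\mathcal{F}(K_{a,b,c})\right| = \left|\mathcal{F}(K_{a,b,d})\right|$.
   Context: All graphs are finite, undirected and simple, and are considered up to isomorphism. $K_{a,b,c}$ denotes the complete tripartite graph with parts of sizes $a,b,c$. A Triangle-Y ($\nabla Y$) move on a graph takes a 3-cycle with vertices $x,y,z$, deletes the edges $xy,yz,zx$, and adds a new vertex $v$ with edges $xv,yv,zv$. A Y-Triangle ($Y\nabla$) move is the inverse operation: for a vertex $v$ of degree three whose neighbours $x,y,z$ are pairwise non-adjacent, delete $v$ and add the edges $xy,yz,zx$. Two graphs are cousins if one is obtained from the other by a sequence of zero or more $\nabla Y$ and $Y\nabla$ moves. The family $\mathcal{F}(G)$ is the set of (isomorphism classes of) cousins of $G$, and $|\mathcal{F}(G)|$ is its size. *)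

theory Defs
  imports Main
begin

type_synonym 'a graph = "'a set \<times> 'a set set"

abbreviation verts :: "'a graph \<Rightarrow> 'a set" where "verts \<equiv> fst"
abbreviation edges :: "'a graph \<Rightarrow> 'a set set" where "edges \<equiv> snd"

definition simple_graph :: "'a graph \<Rightarrow> bool" where
  "simple_graph G \<longleftrightarrow> finite (verts G) \<and> (\<forall>e\<in>edges G. e \<subseteq> verts G \<and> card e = 2)"

definition neighbours :: "'a graph \<Rightarrow> 'a \<Rightarrow> 'a set" where
  "neighbours G v = {u. {v, u} \<in> edges G}"

definition graph_iso :: "'a graph \<Rightarrow> 'b graph \<Rightarrow> bool" where
  "graph_iso G H \<longleftrightarrow> (\<exists>f. bij_betw f (verts G) (verts H) \<and> edges H = (`) f ` edges G)"

definition triangle_Y :: "'a graph \<Rightarrow> 'a graph \<Rightarrow> bool" where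
  "triangle_Y G H \<longleftrightarrow>
     (\<exists>x y z v. {x, y} \<in> edges G \<and> {y, z} \<in> edges G \<and> {z, x} \<in> edges G \<and> v \<notin> verts G \<and>
        H = (insert v (verts G),
             (edges G - {{x, y}, {y, z}, {z, x}}) \<union> {{x, v}, {y, v}, {z, v}}))"

definition Y_triangle :: "'a graph \<Rightarrow> 'a graph \<Rightarrow> bool" where
  "Y_triangle G H \<longleftrightarrow>
     (\<exists>x y z v. v \<in> verts G \<and> neighbours G v = {x, y, z} \<and> card {x, y, z} = 3 \<and>
        {x, y} \<notin> edges G \<and> {y, z} \<notin> edges G \<and> {z, x} \<notin> edges G \<and>
        H = (verts G - {v},
             (edges G - {{x, v}, {y, v}, {z, v}}) \<union> {{x, y}, {y, z}, {z, x}}))"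

definition cousin :: "'a graph \<Rightarrow> 'a graph \<Rightarrow> bool" where
  "cousin G H \<longleftrightarrow> (\<exists>H'. (\<lambda>A B. triangle_Y A B \<or> Y_triangle A B)\<^sup>*\<^sup>* G H' \<and> graph_iso H' H)"

text \<open>Isomorphism classes are formed among simple graphs with vertices in \<open>nat\<close>: every finite
  graph has such a copy, and a new vertex for a Triangle-Y move is always available.\<close>

definition iso_rel :: "(nat graph \<times> nat graph) set" where
  "iso_rel = {(G, H). simple_graph G \<and> simple_graph H \<and> graph_iso G H}"

definition family :: "nat graph \<Rightarrow> nat graph set set" where
  "family G = {H. simple_graph H \<and> cousin G H} // iso_rel"

text \<open>The parts are \<open>{0..<a}\<close>, \<open>{a..<a+b}\<close> and \<open>{a+b..<a+b+c}\<close>.\<close>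

definition complete_tripartite :: "nat \<Rightarrow> nat \<Rightarrow> nat \<Rightarrow> nat graph" where
  "complete_tripartite a b c =
     ({0..<a+b+c},
      {{i, j} | i j. i \<in> {0..<a} \<and> j \<in> {a..<a+b}} \<union>
      {{i, j} | i j. i \<in> {0..<a} \<and> j \<in> {a+b..<a+b+c}} \<union>
      {{i, j} | i j. i \<in> {a..<a+b} \<and> j \<in> {a+b..<a+b+c}})"

lemma simple_complete_tripartite: "simple_graph (complete_tripartite a b c)"
  by (auto simp: simple_graph_def complete_tripartite_def card_insert_if)

lemma simple_graphD:
  assumes "simple_graph G" "{x, y} \<in> edges G"
  shows "x \<noteq> y" "x \<in> verts G" "y \<in> verts G"
  using assms by (fastforce simp: simple_graph_def)+

lemma finite_edges:
  assumes "simple_graph G"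
  shows "finite (edges G)"
  using assms by (intro finite_subset[of "edges G" "Pow (verts G)"]) (auto simp: simple_graph_def)

lemma triangle_Y_simple:
  assumes "simple_graph G" "triangle_Y G H"
  shows "simple_graph H"
proof -
  obtain x y z v where *: "{x, y} \<in> edges G" "{y, z} \<in> edges G" "{z, x} \<in> edges G"
    and v: "v \<notin> verts G"
    and H: "H = (insert v (verts G), (edges G - {{x, y}, {y, z}, {z, x}}) \<union> {{x, v}, {y, v}, {z, v}})"
    using assms(2) by (auto simp: triangle_Y_def)
  note d = simple_graphD[OF assms(1) *(1)] simple_graphD[OF assms(1) *(2)]
  show ?thesis using assms(1) v d by (auto simp: H simple_graph_def card_2_iff doubleton_eq_iff)
qed

lemma Y_triangle_iff_triangle_Y:
  assumes "simple_graph G" "simple_graph H"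
  shows "Y_triangle G H \<longleftrightarrow> triangle_Y H G"
proof
  assume "Y_triangle G H"
  then obtain x y z v where v: "v \<in> verts G" and n: "neighbours G v = {x, y, z}"
    and c: "card {x, y, z} = 3" and ne: "{x, y} \<notin> edges G" "{y, z} \<notin> edges G" "{z, x} \<notin> edges G"
    and H: "H = (verts G - {v}, (edges G - {{x, v}, {y, v}, {z, v}}) \<union> {{x, y}, {y, z}, {z, x}})"
    by (auto simp: Y_triangle_def)
  have e: "{x, v} \<in> edges G" "{y, v} \<in> edges G" "{z, v} \<in> edges G"
    using n by (auto simp: neighbours_def insert_commute)
  have d: "x \<noteq> v" "y \<noteq> v" "z \<noteq> v" using simple_graphD[OF assms(1)] e by auto
  have "edges G = (edges H - {{x, y}, {y, z}, {z, x}}) \<union> {{x, v}, {y, v}, {z, v}}"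
    using e ne d by (auto simp: H)
  moreover have "verts G = insert v (verts H)" using v by (auto simp: H)
  ultimately have "G = (insert v (verts H),
      (edges H - {{x, y}, {y, z}, {z, x}}) \<union> {{x, v}, {y, v}, {z, v}})"
    by (metis prod.collapse)
  moreover have "{x, y} \<in> edges H" "{y, z} \<in> edges H" "{z, x} \<in> edges H" "v \<notin> verts H"
    by (auto simp: H)
  ultimately show "triangle_Y H G" unfolding triangle_Y_def by blast
next
  assume "triangle_Y H G"
  then obtain x y z v where e: "{x, y} \<in> edges H" "{y, z} \<in> edges H" "{z, x} \<in> edges H"
    and v: "v \<notin> verts H"
    and G: "G = (insert v (verts H), (edges H - {{x, y}, {y, z}, {z, x}}) \<union> {{x, v}, {y, v}, {z, v}})"
    by (auto simp: triangle_Y_def)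
  note d = simple_graphD[OF assms(2) e(1)] simple_graphD[OF assms(2) e(2)]
    simple_graphD[OF assms(2) e(3)]
  have dv: "x \<noteq> v" "y \<noteq> v" "z \<noteq> v" using d v by auto
  have nv: "w \<notin> edges H" if "v \<in> w" for w
    using that v assms(2) by (auto simp: simple_graph_def)
  have "neighbours G v = {x, y, z}"
    using nv by (auto simp: neighbours_def G doubleton_eq_iff)
  moreover have "card {x, y, z} = 3" using d by auto
  moreover have "{x, y} \<notin> edges G" "{y, z} \<notin> edges G" "{z, x} \<notin> edges G"
    using dv by (auto simp: G doubleton_eq_iff)
  moreover have "edges H = (edges G - {{x, v}, {y, v}, {z, v}}) \<union> {{x, y}, {y, z}, {z, x}}"
    using e nv by (auto simp: G)
  moreover have "verts H = verts G - {v}" using v by (auto simp: G)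
  moreover have "v \<in> verts G" by (simp add: G)
  ultimately show "Y_triangle G H" unfolding Y_triangle_def by (metis prod.collapse)
qed

lemma Y_triangle_simple:
  assumes "simple_graph G" "Y_triangle G H"
  shows "simple_graph H"
proof -
  obtain x y z v where v: "v \<in> verts G" and n: "neighbours G v = {x, y, z}"
    and c: "card {x, y, z} = 3"
    and H: "H = (verts G - {v}, (edges G - {{x, v}, {y, v}, {z, v}}) \<union> {{x, y}, {y, z}, {z, x}})"
    using assms(2) by (auto simp: Y_triangle_def)
  have e: "{v, x} \<in> edges G" "{v, y} \<in> edges G" "{v, z} \<in> edges G"
    using n by (auto simp: neighbours_def)
  note d = simple_graphD[OF assms(1) e(1)] simple_graphD[OF assms(1) e(2)]
    simple_graphD[OF assms(1) e(3)]
  have xyz: "x \<noteq> y" "y \<noteq> z" "z \<noteq> x"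
    using c by (auto simp: card_insert_if split: if_splits)
  have "w \<subseteq> verts G - {v} \<and> card w = 2" if w: "w \<in> edges H" for w
  proof (cases "w \<in> {{x, y}, {y, z}, {z, x}}")
    case True
    then show ?thesis using d xyz by auto
  next
    case False
    then have wE: "w \<in> edges G" and wn: "w \<notin> {{x, v}, {y, v}, {z, v}}" using w by (auto simp: H)
    then have w2: "w \<subseteq> verts G" "card w = 2" using assms(1) by (auto simp: simple_graph_def)
    have "v \<notin> w"
    proof
      assume "v \<in> w"
      then obtain u where "w = {v, u}" using w2(2) by (auto simp: card_2_iff)
      then show False using wE wn n by (auto simp: neighbours_def insert_commute)
    qed
    then show ?thesis using w2 by auto
  qed
  then show ?thesis using assms(1) by (simp add: simple_graph_def H)
qed

lemma triangle_Y_invariants: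
  assumes "simple_graph G" "triangle_Y G H"
  shows "card (edges H) = card (edges G)"
    and "verts H - \<Union> (edges H) = verts G - \<Union> (edges G)"
proof -
  obtain x y z v where e: "{x, y} \<in> edges G" "{y, z} \<in> edges G" "{z, x} \<in> edges G"
    and v: "v \<notin> verts G"
    and H: "H = (insert v (verts G), (edges G - {{x, y}, {y, z}, {z, x}}) \<union> {{x, v}, {y, v}, {z, v}})"
    using assms(2) by (auto simp: triangle_Y_def)
  note d = simple_graphD[OF assms(1) e(1)] simple_graphD[OF assms(1) e(2)]
    simple_graphD[OF assms(1) e(3)]
  have nv: "v \<notin> w" if "w \<in> edges G" for w
    using that v assms(1) by (auto simp: simple_graph_def)
  have fin: "finite (edges G)" by (rule finite_edges[OF assms(1)])
  have c3: "card {{x, y}, {y, z}, {z, x}} = 3" "card {{x, v}, {y, v}, {z, v}} = 3"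
    using d v by (auto simp: doubleton_eq_iff card_insert_if)
  have "card (edges H) = card (edges G - {{x, y}, {y, z}, {z, x}}) + card {{x, v}, {y, v}, {z, v}}"
    using fin nv by (subst card_Un_disjoint[symmetric]) (auto simp: H)
  also have "\<dots> = card (edges G) - 3 + 3"
    using e c3 by (subst card_Diff_subset) auto
  also have "card {{x, y}, {y, z}, {z, x}} \<le> card (edges G)"
    using e fin by (intro card_mono) auto
  then have "card (edges G) - 3 + 3 = card (edges G)" using c3(1) by linarith
  finally show "card (edges H) = card (edges G)" .
  show "verts H - \<Union> (edges H) = verts G - \<Union> (edges G)"
    using e v by (auto simp: H)
qed

lemma iso_rel_equiv: "equiv {G. simple_graph G} iso_rel"
proof (rule equivI)
  show "iso_rel \<subseteq> {G. simple_graph G} \<times> {G. simple_graph G}" by (auto simp: iso_rel_def)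
  show "refl_on {G. simple_graph G} iso_rel"
    by (auto simp: refl_on_def iso_rel_def graph_iso_def intro!: exI[of _ id])
  show "sym iso_rel"
  proof (rule symI)
    fix G H assume "(G, H) \<in> iso_rel"
    then obtain f where s: "simple_graph G" "simple_graph H"
      and f: "bij_betw f (verts G) (verts H)" "edges H = (`) f ` edges G"
      by (auto simp: iso_rel_def graph_iso_def)
    let ?g = "inv_into (verts G) f"
    have "?g ` f ` e = e" if "e \<in> edges G" for e
      using that s(1) f(1) by (intro inv_into_image_cancel) (auto simp: bij_betw_def simple_graph_def)
    then have "edges G = (`) ?g ` edges H" by (force simp: f(2) image_image)
    then show "(H, G) \<in> iso_rel"
      using s bij_betw_inv_into[OF f(1)] by (auto simp: iso_rel_def graph_iso_def)
  qed
  show "trans iso_rel"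
  proof (rule transI)
    fix G H K assume "(G, H) \<in> iso_rel" "(H, K) \<in> iso_rel"
    then obtain f g where s: "simple_graph G" "simple_graph K"
      and f: "bij_betw f (verts G) (verts H)" "edges H = (`) f ` edges G"
      and g: "bij_betw g (verts H) (verts K)" "edges K = (`) g ` edges H"
      by (auto simp: iso_rel_def graph_iso_def)
    have "edges K = (`) (g \<circ> f) ` edges G" by (auto simp: f g image_image image_comp)
    then show "(G, K) \<in> iso_rel"
      using s bij_betw_trans[OF f(1) g(1)] by (auto simp: iso_rel_def graph_iso_def)
  qed
qed

text \<open>The number of edges and the set of isolated vertices are invariant under both moves, so a
  family is finite and its cardinality is not the default value for infinite sets.\<close>

lemma finite_family:
  assumes G: "simple_graph G"
  shows "finite (family G)"
proof -
  define I where "I = verts G - \<Union> (edges G)"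
  define m where "m = card (edges G)"
  define N where "N = card I + 2 * m"
  have step: "simple_graph H \<and> card (edges H) = m \<and> verts H - \<Union> (edges H) = I"
    if "(\<lambda>A B. triangle_Y A B \<or> Y_triangle A B)\<^sup>*\<^sup>* G H" for H
    using that
  proof induction
    case base
    then show ?case using G by (simp add: I_def m_def)
  next
    case (step A B)
    then show ?case
      by (metis triangle_Y_simple Y_triangle_simple triangle_Y_invariants Y_triangle_iff_triangle_Y)
  qed
  let ?B = "Pow {..<N} \<times> Pow (Pow {..<N})"
  have "family G \<subseteq> (\<lambda>H. iso_rel `` {H}) ` ?B"
  proof
    fix C assume "C \<in> family G"
    then obtain H H' where C: "C = iso_rel `` {H}" and H: "simple_graph H"
      and H': "(\<lambda>A B. triangle_Y A B \<or> Y_triangle A B)\<^sup>*\<^sup>* G H'" "graph_iso H' H"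
      by (auto simp: family_def quotient_def cousin_def)
    have s: "simple_graph H'" "card (edges H') = m" "verts H' - \<Union> (edges H') = I"
      using step[OF H'(1)] by auto
    have HH: "(H', H) \<in> iso_rel" using s H H'(2) by (simp add: iso_rel_def)
    have finV: "finite (verts H')" using s(1) by (simp add: simple_graph_def)
    have "card (verts H') \<le> card (I \<union> \<Union> (edges H'))"
      using s(1) finV by (intro card_mono) (auto simp: s(3)[symmetric] simple_graph_def intro: finite_subset)
    also have "\<dots> \<le> card I + card (\<Union> (edges H'))" by (rule card_Un_le)
    also have "card (\<Union> (edges H')) \<le> (\<Sum>e\<in>edges H'. card e)"
      by (rule card_Union_le_sum_card)
    also have "\<dots> = 2 * m" using s(1,2) by (simp add: simple_graph_def)
    finally have le: "card (verts H') \<le> N" by (simp add: N_def)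
    obtain f where f: "bij_betw f (verts H') {0..<card (verts H')}"
      using ex_bij_betw_finite_nat[OF finV] by blast
    define K where "K = (f ` verts H', (`) f ` edges H')"
    have inj: "inj_on f (verts H')" using f by (simp add: bij_betw_def)
    have img: "f ` verts H' \<subseteq> {..<N}" using f le by (auto simp: bij_betw_def)
    have "card (f ` e) = 2" if "e \<in> edges H'" for e
      using that s(1) inj by (metis card_image inj_on_subset simple_graph_def)
    then have "simple_graph K" using s(1) by (auto simp: K_def simple_graph_def)
    moreover have "graph_iso H' K"
      using inj by (auto simp: K_def graph_iso_def bij_betw_def intro!: exI[of _ f])
    ultimately have "(H', K) \<in> iso_rel" using s(1) by (simp add: iso_rel_def)
    then have "C = iso_rel `` {K}"
      using C HH equiv_class_eq[OF iso_rel_equiv] by metis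
    moreover have "K \<in> ?B"
      using img s(1) by (auto simp: K_def simple_graph_def)
    ultimately show "C \<in> (\<lambda>H. iso_rel `` {H}) ` ?B" by blast
  qed
  then show ?thesis by (rule finite_subset) simp
qed

end

theory Submission
  imports Defs
begin

text \<open>Let \<open>S = A \<union> B\<close>. Both moves preserve the number of components of \<open>G - S\<close> that are adjacent to
  all of \<open>S\<close> (here \<open>|S| \<noteq> 3\<close>, i.e. \<open>(a, b) \<noteq> (1, 2)\<close>, is used), so every cousin of \<open>K_{a,b,c}\<close> has \<open>c\<close>
  of them and vertices of \<open>S\<close>, having degree at least \<open>c \<ge> 4\<close>, are never removed. Such a component
  accounts for at least \<open>|S|\<close> edges, and for more unless it is a single vertex with neighbourhood \<open>S\<close>;
  since the number \<open>ab + (a + b)c\<close> of edges is invariant, a cousin of \<open>K_{a,b,c+1}\<close> with \<open>c \<ge> ab\<close> always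
  has a vertex with neighbourhood \<open>S\<close>. Deleting it yields a cousin of \<open>K_{a,b,c}\<close>, and adding it is the
  inverse operation.

  On isomorphism classes this is well defined because \<open>S\<close> is determined by the cousin: any other
  set with the same component count could be followed back along the moves to \<open>K_{a,b,c}\<close>, where
  only \<open>A \<union> B\<close> qualifies, except for \<open>a = 1\<close>, \<open>b = c\<close>, where \<open>A \<union> C\<close> does too. In that case the cousins
  are obtained from disjointly chosen triangles through the vertex of \<open>A\<close>, and their number determines the
  isomorphism type.\<close>

subsection \<open>Isomorphisms\<close>

definition map_graph :: "('a \<Rightarrow> 'b) \<Rightarrow> 'a graph \<Rightarrow> 'b graph" where
  "map_graph h G = (h ` verts G, (`) h ` edges G)"

lemma verts_map_graph [simp]: "verts (map_graph h G) = h ` verts G"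
  and edges_map_graph [simp]: "edges (map_graph h G) = (`) h ` edges G"
  by (simp_all add: map_graph_def)

lemma map_graph_id [simp]: "map_graph id G = G"
  by (simp add: map_graph_def)

text \<open>With an equation \<open>H = map_graph h G\<close> in place of a bijection, isomorphisms
  can be composed, inverted and transported by rewriting.\<close>

lemma graph_iso_map_graph: "graph_iso G H \<longleftrightarrow> (\<exists>h. inj_on h (verts G) \<and> H = map_graph h G)"
  unfolding graph_iso_def bij_betw_def map_graph_def by (metis fst_conv snd_conv prod.collapse)

lemma edge_subset: "simple_graph G \<Longrightarrow> e \<in> edges G \<Longrightarrow> e \<subseteq> verts G"
  by (auto simp: simple_graph_def)

lemma simple_map_graph:
  assumes "simple_graph G" "inj_on h (verts G)"
  shows "simple_graph (map_graph h G)"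
proof -
  have "card (h ` e) = 2" if "e \<in> edges G" for e
    using that assms by (metis card_image inj_on_subset simple_graph_def)
  then show ?thesis using assms by (auto simp: simple_graph_def)
qed

lemma map_graph_comp: "map_graph g (map_graph h G) = map_graph (g \<circ> h) G"
  by (auto simp: map_graph_def image_comp)

lemma map_graph_cong:
  assumes "simple_graph G" "\<And>x. x \<in> verts G \<Longrightarrow> g x = h x"
  shows "map_graph g G = map_graph h G"
proof -
  have "g ` e = h ` e" if "e \<in> edges G" for e
    using edge_subset[OF assms(1) that] assms(2) by (auto intro!: image_cong)
  then show ?thesis using assms(2) by (auto simp: map_graph_def intro!: image_cong)
qed

lemma map_graph_inv:
  assumes "simple_graph G" "inj_on h (verts G)"
  shows "map_graph (inv_into (verts G) h) (map_graph h G) = G"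
proof -
  have "map_graph (inv_into (verts G) h) (map_graph h G) = map_graph id G"
    unfolding map_graph_comp using assms by (intro map_graph_cong) auto
  then show ?thesis by (simp add: map_graph_def)
qed

lemma map_graph_edge_iff:
  assumes "simple_graph G" "inj_on h (verts G)" "p \<in> verts G" "q \<in> verts G"
  shows "{h p, h q} \<in> edges (map_graph h G) \<longleftrightarrow> {p, q} \<in> edges G"
proof
  assume "{h p, h q} \<in> edges (map_graph h G)"
  then obtain e where e: "e \<in> edges G" "h ` {p, q} = h ` e" by auto
  then have "{p, q} = e"
    using assms edge_subset[OF assms(1) e(1)] inj_on_image_eq_iff[OF assms(2), of "{p, q}" e] by auto
  then show "{p, q} \<in> edges G" using e(1) by simp
next
  assume "{p, q} \<in> edges G"
  then have "h ` {p, q} \<in> edges (map_graph h G)" unfolding edges_map_graph by blast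
  then show "{h p, h q} \<in> edges (map_graph h G)" by simp
qed

text \<open>Injectivity on \<open>verts H\<close>, which contains the new vertex, keeps its image
  new; it also makes taking images commute with removing the three edges.\<close>

lemma triangle_Y_map_graph:
  assumes "simple_graph G" "triangle_Y G H" "inj_on h (verts H)"
  shows "triangle_Y (map_graph h G) (map_graph h H)"
proof -
  obtain x y z v where e: "{x, y} \<in> edges G" "{y, z} \<in> edges G" "{z, x} \<in> edges G"
    and v: "v \<notin> verts G"
    and H: "H = (insert v (verts G), (edges G - {{x, y}, {y, z}, {z, x}}) \<union> {{x, v}, {y, v}, {z, v}})"
    using assms(2) by (auto simp: triangle_Y_def)
  have inj: "inj_on h (verts G)" "h v \<notin> h ` verts G" using assms(3) v by (auto simp: H)
  have injE: "inj_on ((`) h) (edges G)"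
    using inj(1) edge_subset[OF assms(1)] by (intro inj_onI) (metis inj_on_image_eq_iff)
  have d: "(`) h ` (edges G - {{x, y}, {y, z}, {z, x}})
      = (`) h ` edges G - (`) h ` {{x, y}, {y, z}, {z, x}}"
    using e by (intro inj_on_image_set_diff[OF injE]) auto
  have "{h p, h q} \<in> (`) h ` edges G" if "{p, q} \<in> edges G" for p q
  proof -
    have "h ` {p, q} \<in> (`) h ` edges G" using that by (rule imageI)
    then show ?thesis by simp
  qed
  then have "{h x, h y} \<in> (`) h ` edges G" "{h y, h z} \<in> (`) h ` edges G" "{h z, h x} \<in> (`) h ` edges G"
    using e by simp_all
  moreover have "map_graph h H = (insert (h v) (h ` verts G),
      (`) h ` edges G - {{h x, h y}, {h y, h z}, {h z, h x}} \<union> {{h x, h v}, {h y, h v}, {h z, h v}})"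
    unfolding map_graph_def by (simp add: H image_Un d)
  ultimately show ?thesis unfolding triangle_Y_def verts_map_graph edges_map_graph using inj(2) by blast
qed

section \<open>Moves up to isomorphism\<close>

abbreviation move :: "'a graph \<Rightarrow> 'a graph \<Rightarrow> bool" where
  "move A B \<equiv> triangle_Y A B \<or> Y_triangle A B"

lemma move_simple: "simple_graph G \<Longrightarrow> move G H \<Longrightarrow> simple_graph H"
  using triangle_Y_simple Y_triangle_simple by blast

lemma moves_simple: "move\<^sup>*\<^sup>* G H \<Longrightarrow> simple_graph G \<Longrightarrow> simple_graph H"
  by (induction rule: rtranclp_induct) (auto dest: move_simple)

lemma graph_iso_sym: "simple_graph G \<Longrightarrow> graph_iso G H \<Longrightarrow> graph_iso H G"
  by (metis graph_iso_map_graph inj_on_inv_into map_graph_inv order_refl verts_map_graph)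

lemma graph_iso_trans:
  assumes "graph_iso G H" "graph_iso H K"
  shows "graph_iso G K"
proof -
  obtain g h where g: "inj_on g (verts G)" "H = map_graph g G"
    and h: "inj_on h (verts H)" "K = map_graph h H"
    using assms by (auto simp: graph_iso_map_graph)
  have "inj_on (h \<circ> g) (verts G)" using g h by (auto intro: comp_inj_on)
  then show ?thesis using g h by (auto simp: graph_iso_map_graph map_graph_comp)
qed

text \<open>\<open>cousin\<close> allows an isomorphism only after the last move; this lets a
  further move pass in front of it.\<close>

lemma move_transport:
  fixes G G' H :: "nat graph"
  assumes s: "simple_graph G" and iso: "graph_iso G' G" and s': "simple_graph G'" and m: "move G H"
  obtains H' where "move G' H'" "graph_iso H' H"
proof -
  have sH: "simple_graph H" using move_simple[OF s m] .
  obtain g where g: "inj_on g (verts G)" "G' = map_graph g G"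
    using graph_iso_sym[OF s' iso] by (auto simp: graph_iso_map_graph)
  have "\<exists>h. inj_on h (verts H) \<and> move G' (map_graph h H)"
  proof (cases "triangle_Y G H")
    case True
    then obtain v where v: "v \<notin> verts G" "verts H = insert v (verts G)"
      by (auto simp: triangle_Y_def)
    have "finite (g ` verts G)" using s by (simp add: simple_graph_def)
    then obtain w where w: "w \<notin> g ` verts G" using ex_new_if_finite[OF infinite_UNIV_nat] by metis
    define h where "h = g(v := w)"
    have hg: "h x = g x" if "x \<in> verts G" for x using that v by (auto simp: h_def)
    have img: "h ` verts G = g ` verts G" using hg by (auto intro!: image_cong)
    have "inj_on h (verts G)" using g(1) hg by (simp add: inj_on_def)
    then have "inj_on h (verts H)" using v w img by (simp add: h_def)
    moreover have "map_graph h G = G'" unfolding g(2) using s hg by (rule map_graph_cong)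
    ultimately show ?thesis using triangle_Y_map_graph[OF s True] by metis
  next
    case False
    then have "Y_triangle G H" using m by simp
    then have t: "triangle_Y H G" using Y_triangle_iff_triangle_Y[OF s sH] by simp
    have "verts H \<subseteq> verts G" using t by (auto simp: triangle_Y_def)
    then have i: "inj_on g (verts H)" by (rule inj_on_subset[OF g(1)])
    have "triangle_Y (map_graph g H) G'" unfolding g(2) by (rule triangle_Y_map_graph[OF sH t g(1)])
    then show ?thesis using i Y_triangle_iff_triangle_Y[OF s' simple_map_graph[OF sH i]] by blast
  qed
  then obtain h where "inj_on h (verts H)" "move G' (map_graph h H)" by blast
  then show ?thesis
    using that graph_iso_sym[OF sH] by (metis graph_iso_map_graph)
qed

lemma cousin_move:
  fixes K :: "nat graph"
  assumes "simple_graph K" "cousin K G" "simple_graph G" "move G H"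
  shows "cousin K H"
proof -
  obtain G' where G': "move\<^sup>*\<^sup>* K G'" "graph_iso G' G" using assms(2) by (auto simp: cousin_def)
  obtain H' where "move G' H'" "graph_iso H' H"
    using move_transport[OF assms(3) G'(2) moves_simple[OF G'(1) assms(1)] assms(4)] .
  then show ?thesis using G'(1) unfolding cousin_def
    by (metis (no_types, lifting) rtranclp.rtrancl_into_rtrancl)
qed

subsection \<open>Bridges of a vertex set\<close>

text \<open>\<open>bridge G S K\<close> says that \<open>K\<close> is a component of \<open>G - S\<close> adjacent to every vertex of \<open>S\<close>:
  components are the atoms among the sets that no edge of \<open>G - S\<close> leaves.\<close>

definition closed_off :: "'a graph \<Rightarrow> 'a set \<Rightarrow> 'a set \<Rightarrow> bool" where
  "closed_off G S P \<longleftrightarrow> P \<subseteq> verts G - S \<and> (\<forall>p q. {p, q} \<in> edges G \<longrightarrow> p \<in> P \<longrightarrow> q \<in> P \<union> S)"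

definition bridge :: "'a graph \<Rightarrow> 'a set \<Rightarrow> 'a set \<Rightarrow> bool" where
  "bridge G S K \<longleftrightarrow> closed_off G S K \<and> K \<noteq> {} \<and>
     (\<forall>P. closed_off G S P \<longrightarrow> P \<subseteq> K \<longrightarrow> P = {} \<or> P = K) \<and>
     (\<forall>s\<in>S. \<exists>k\<in>K. {s, k} \<in> edges G)"

lemma closed_offD: "closed_off G S P \<Longrightarrow> {p, q} \<in> edges G \<Longrightarrow> p \<in> P \<Longrightarrow> q \<in> P \<union> S"
  unfolding closed_off_def by blast

lemma bridge_atom: "bridge G S K \<Longrightarrow> closed_off G S P \<Longrightarrow> P \<subseteq> K \<Longrightarrow> P = {} \<or> P = K"
  unfolding bridge_def by blast

text \<open>The intersection of two closed-off sets is closed off, so two atoms that meet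
  coincide.\<close>

lemma bridge_disjoint:
  assumes "bridge G S K" "bridge G S L" "K \<noteq> L"
  shows "K \<inter> L = {}"
proof -
  have "closed_off G S K" "closed_off G S L" using assms(1,2) by (simp_all add: bridge_def)
  then have "closed_off G S (K \<inter> L)" unfolding closed_off_def by blast
  then have "K \<inter> L = {} \<or> K \<inter> L = K" "K \<inter> L = {} \<or> K \<inter> L = L"
    using bridge_atom[OF assms(1)] bridge_atom[OF assms(2)] by simp_all
  then show ?thesis using assms(3) by argo
qed

lemma finite_bridges: "simple_graph G \<Longrightarrow> finite {K. bridge G S K}"
  by (rule finite_subset[of _ "Pow (verts G)"])
     (auto simp: bridge_def closed_off_def simple_graph_def)

lemma closed_off_map_graph:
  assumes s: "simple_graph G" and i: "inj_on h (verts G)" and S: "S \<subseteq> verts G" and P: "closed_off G S P"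
  shows "closed_off (map_graph h G) (h ` S) (h ` P)"
proof -
  have PV: "P \<subseteq> verts G" "P \<inter> S = {}" using P by (auto simp: closed_off_def)
  have "h ` P \<inter> h ` S = {}" using PV S i by (metis inj_on_image_Int image_empty)
  moreover have "q \<in> h ` P \<union> h ` S" if e: "{p, q} \<in> edges (map_graph h G)" and p: "p \<in> h ` P" for p q
  proof -
    have "{p, q} \<subseteq> h ` verts G" using edge_subset[OF simple_map_graph[OF s i] e] by simp
    then obtain q' where q': "q' \<in> verts G" "q = h q'" by auto
    obtain p' where p': "p' \<in> P" "p = h p'" using p by auto
    have "{p', q'} \<in> edges G" using e p' q' PV map_graph_edge_iff[OF s i] by (metis subsetD)
    then show ?thesis using closed_offD[OF P] p' q' by blast
  qed
  ultimately show ?thesis using PV unfolding closed_off_def by auto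
qed

lemma bridge_map_graph:
  assumes s: "simple_graph G" and i: "inj_on h (verts G)" and S: "S \<subseteq> verts G" and K: "bridge G S K"
  shows "bridge (map_graph h G) (h ` S) (h ` K)"
proof -
  let ?g = "inv_into (verts G) h"
  have KV: "K \<subseteq> verts G" using K by (auto simp: bridge_def closed_off_def)
  have "P = {} \<or> P = h ` K" if P: "closed_off (map_graph h G) (h ` S) P" "P \<subseteq> h ` K" for P
  proof -
    have "closed_off (map_graph ?g (map_graph h G)) (?g ` h ` S) (?g ` P)"
      using P(1) S by (intro closed_off_map_graph simple_map_graph s i) (auto intro: inj_on_inv_into)
    then have "closed_off G S (?g ` P)" using map_graph_inv[OF s i] S i by simp
    moreover have "?g ` P \<subseteq> K" using P(2) KV i by fastforce
    ultimately have "?g ` P = {} \<or> ?g ` P = K" by (rule bridge_atom[OF K])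
    moreover have "h ` ?g ` P = P"
      using P(2) KV by (intro image_inv_into_cancel[of h "verts G" "h ` verts G"]) auto
    ultimately show ?thesis by (metis image_empty)
  qed
  moreover have "\<exists>k\<in>h ` K. {t, k} \<in> edges (map_graph h G)" if "t \<in> h ` S" for t
  proof -
    obtain u where u: "u \<in> S" "t = h u" using \<open>t \<in> h ` S\<close> by auto
    obtain k where "k \<in> K" "{u, k} \<in> edges G" using u K by (auto simp: bridge_def)
    moreover have "{h u, h k} \<in> edges (map_graph h G)"
      using calculation u S KV by (subst map_graph_edge_iff[OF s i]) auto
    ultimately show ?thesis using u by blast
  qed
  moreover have "closed_off (map_graph h G) (h ` S) (h ` K)" "h ` K \<noteq> {}"
    using K by (auto simp: bridge_def intro!: closed_off_map_graph[OF s i S])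
  ultimately show ?thesis unfolding bridge_def by blast
qed

text \<open>The invariant carried through sequences of moves. It is applied to
  \<open>A \<union> B\<close> and, when \<open>a = 1\<close>, also to \<open>A \<union> C\<close>;
  well-formedness is bundled in so that it is preserved along with the count.\<close>

definition frame :: "nat \<Rightarrow> nat \<Rightarrow> 'a graph \<Rightarrow> 'a set \<Rightarrow> bool" where
  "frame n c G S \<longleftrightarrow> simple_graph G \<and> S \<subseteq> verts G \<and> card S = n \<and> card {K. bridge G S K} = c"

lemma frame_map_graph:
  assumes F: "frame n c G S" and i: "inj_on h (verts G)"
  shows "frame n c (map_graph h G) (h ` S)"
proof -
  let ?g = "inv_into (verts G) h"
  have s: "simple_graph G" and S: "S \<subseteq> verts G" "card S = n" and c: "card {K. bridge G S K} = c"
    using F by (auto simp: frame_def)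
  note s' = simple_map_graph[OF s i]
  have KV: "K \<in> Pow (verts G)" if "bridge G S K" for K
    using that by (auto simp: bridge_def closed_off_def)
  have "{K. bridge (map_graph h G) (h ` S) K} = (`) h ` {K. bridge G S K}" (is "?L = ?R")
  proof
    show "?R \<subseteq> ?L" using bridge_map_graph[OF s i S(1)] by auto
    show "?L \<subseteq> ?R"
    proof
      fix L assume "L \<in> ?L"
      then have L: "bridge (map_graph h G) (h ` S) L" by simp
      have "bridge (map_graph ?g (map_graph h G)) (?g ` h ` S) (?g ` L)"
        using L S by (intro bridge_map_graph s') (auto intro: inj_on_inv_into)
      then have "bridge G S (?g ` L)" using map_graph_inv[OF s i] S i by simp
      moreover have "h ` ?g ` L = L"
        using L by (intro image_inv_into_cancel) (auto simp: bridge_def closed_off_def)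
      ultimately show "L \<in> ?R" by (metis imageI mem_Collect_eq)
    qed
  qed
  moreover have "inj_on ((`) h) {K. bridge G S K}"
    using inj_on_image_Pow[OF i] KV by (auto intro: inj_on_subset)
  moreover have "card (h ` S) = n" using S i by (metis card_image inj_on_subset)
  ultimately show ?thesis using s' S c by (auto simp: frame_def card_image)
qed

section \<open>Bridges under a Triangle-Y move\<close>

text \<open>\<open>S \<subseteq> verts G\<close> keeps the new vertex \<open>v\<close> out of
  \<open>S\<close>, and \<open>card S \<noteq> 3\<close> prevents the corners \<open>x, y, z\<close>
  from making up all of \<open>S\<close>.\<close>

locale delta_wye =
  fixes G H :: "'a graph" and S :: "'a set" and x y z v :: 'a
  assumes simple: "simple_graph G"
    and triangle: "{x, y} \<in> edges G" "{y, z} \<in> edges G" "{z, x} \<in> edges G"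
    and new: "v \<notin> verts G"
    and H: "H = (insert v (verts G), (edges G - {{x, y}, {y, z}, {z, x}}) \<union> {{x, v}, {y, v}, {z, v}})"
    and S: "S \<subseteq> verts G" "card S \<noteq> 3"
begin

lemma xyz: "x \<in> verts G" "y \<in> verts G" "z \<in> verts G" "x \<noteq> y" "y \<noteq> z" "z \<noteq> x"
  using simple_graphD[OF simple triangle(1)] simple_graphD[OF simple triangle(2)]
    simple_graphD[OF simple triangle(3)] by auto

lemma v_no_edge: "{v, q} \<notin> edges G" "{q, v} \<notin> edges G"
  using simple_graphD[OF simple] new by blast+

lemma v_notin_S: "v \<notin> S" using S new by auto

lemma verts_H: "verts H = insert v (verts G)" by (simp add: H)

lemma v_edge_iff: "{v, q} \<in> edges H \<longleftrightarrow> q \<in> {x, y, z}"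
  using xyz new v_no_edge by (auto simp: H doubleton_eq_iff)

lemma edge_H_iff:
  assumes "p \<noteq> v" "q \<noteq> v"
  shows "{p, q} \<in> edges H \<longleftrightarrow> {p, q} \<in> edges G \<and> \<not> {p, q} \<subseteq> {x, y, z}"
proof -
  have "{p, q} \<in> {{x, y}, {y, z}, {z, x}}" if "{p, q} \<in> edges G" "{p, q} \<subseteq> {x, y, z}"
    using that simple_graphD(1)[OF simple that(1)] by auto
  then show ?thesis using assms by (auto simp: H doubleton_eq_iff)
qed

lemma neighbours_v: "neighbours H v = {x, y, z}"
  using v_edge_iff by (auto simp: neighbours_def)

text \<open>Meant as the inverse of removing \<open>v\<close> from a bridge: in \<open>H\<close>,
  the new vertex belongs to the component of every corner outside \<open>S\<close>.\<close>

definition up :: "'a set \<Rightarrow> 'a set" where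
  "up P = (if P \<inter> {x, y, z} = {} then P else insert v P)"

lemma triangle_edge: "p \<in> {x, y, z} \<Longrightarrow> q \<in> {x, y, z} \<Longrightarrow> p \<noteq> q \<Longrightarrow> {p, q} \<in> edges G"
  using triangle by (auto simp: insert_commute)

text \<open>An edge of \<open>G\<close> is either kept in \<open>H\<close> or is a side of the
  triangle; in the latter case \<open>H\<close> joins its ends by a path through \<open>v\<close>,
  which lies outside \<open>S\<close>.\<close>

lemma closed_down:
  assumes P: "closed_off H S P"
  shows "closed_off G S (P - {v})"
proof -
  have "q \<in> P - {v} \<union> S" if e: "{p, q} \<in> edges G" and p: "p \<in> P - {v}" for p q
  proof -
    have qv: "q \<noteq> v" using e v_no_edge by auto
    show ?thesis
    proof (cases "{p, q} \<subseteq> {x, y, z}")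
      case True
      then have "{p, v} \<in> edges H" "{v, q} \<in> edges H" using v_edge_iff by (auto simp: insert_commute)
      then show ?thesis using closed_offD[OF P] p qv v_notin_S by blast
    next
      case False
      then have "{p, q} \<in> edges H" using e p qv edge_H_iff by auto
      then show ?thesis using closed_offD[OF P] p qv by blast
    qed
  qed
  moreover have "P - {v} \<subseteq> verts G - S" using P verts_H by (auto simp: closed_off_def)
  ultimately show ?thesis by (auto simp: closed_off_def)
qed

lemma closed_triangle:
  assumes "closed_off G S P" "P \<inter> {x, y, z} \<noteq> {}"
  shows "{x, y, z} \<subseteq> P \<union> S"
proof
  fix q assume q: "q \<in> {x, y, z}"
  obtain p where p: "p \<in> P" "p \<in> {x, y, z}" using assms(2) by blast
  show "q \<in> P \<union> S"
  proof (cases "p = q")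
    case True
    then show ?thesis using p by simp
  next
    case False
    then show ?thesis using closed_offD[OF assms(1) triangle_edge[OF p(2) q]] p(1) by simp
  qed
qed

text \<open>The corners are pairwise adjacent in \<open>G\<close>, so a closed-off set that meets
  them contains all corners outside \<open>S\<close>, and adding \<open>v\<close> makes no edge
  leave it.\<close>

lemma closed_up:
  assumes P: "closed_off G S P"
  shows "closed_off H S (up P)"
proof -
  have vP: "v \<notin> P" using P new by (auto simp: closed_off_def)
  have "q \<in> up P \<union> S" if e: "{p, q} \<in> edges H" and p: "p \<in> up P" for p q
  proof -
    consider "p = v" | "q = v" "p \<noteq> v" | "p \<noteq> v" "q \<noteq> v" by auto
    then show ?thesis
    proof cases
      case 1
      then have "q \<in> {x, y, z}" using e v_edge_iff by simp
      moreover have "P \<inter> {x, y, z} \<noteq> {}" using p 1 vP by (auto simp: up_def split: if_splits)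
      ultimately show ?thesis using closed_triangle[OF P] by (auto simp: up_def)
    next
      case 2
      then have "p \<in> {x, y, z}" using e v_edge_iff by (metis insert_commute)
      moreover have "p \<in> P" using p 2 by (auto simp: up_def split: if_splits)
      ultimately show ?thesis using 2 by (auto simp: up_def)
    next
      case 3
      then have "{p, q} \<in> edges G" using e edge_H_iff by simp
      moreover have "p \<in> P" using p 3 by (auto simp: up_def split: if_splits)
      ultimately show ?thesis using closed_offD[OF P] by (fastforce simp: up_def)
    qed
  qed
  moreover have "up P \<subseteq> verts H - S"
    using P v_notin_S verts_H by (auto simp: closed_off_def up_def)
  ultimately show ?thesis by (auto simp: closed_off_def)
qed

lemma closed_v:
  assumes "closed_off H S P" "P \<inter> {x, y, z} \<noteq> {}"
  shows "v \<in> P"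
proof -
  obtain p where p: "p \<in> P" "p \<in> {x, y, z}" using assms(2) by blast
  then have "{p, v} \<in> edges H" using v_edge_iff by (metis insert_commute)
  then show ?thesis using closed_offD[OF assms(1)] p v_notin_S by blast
qed

text \<open>The neighbours of \<open>v\<close> are the three corners, so \<open>{v}\<close> could be
  a bridge only for \<open>S = {x, y, z}\<close>, which the size condition excludes.\<close>

lemma bridge_not_v: "\<not> bridge H S {v}"
proof
  assume b: "bridge H S {v}"
  then have cl: "closed_off H S {v}" by (simp add: bridge_def)
  have "{x, y, z} \<subseteq> S"
  proof
    fix q assume q: "q \<in> {x, y, z}"
    then have "{v, q} \<in> edges H" using v_edge_iff by simp
    then have "q \<in> {v} \<union> S" using closed_offD[OF cl] by simp
    then show "q \<in> S" using q xyz new by auto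
  qed
  moreover have "S \<subseteq> {x, y, z}"
    using b v_edge_iff by (auto simp: bridge_def insert_commute)
  ultimately have "S = {x, y, z}" by blast
  then show False using S(2) xyz by simp
qed

lemma up_down:
  assumes b: "bridge H S K"
  shows "up (K - {v}) = K"
proof -
  have cl: "closed_off H S K" using b by (simp add: bridge_def)
  show ?thesis
  proof (cases "v \<in> K")
    case True
    have "(K - {v}) \<inter> {x, y, z} \<noteq> {}"
    proof
      \<comment> \<open>Without a corner in \<open>K\<close>, all neighbours of \<open>v\<close> lie
        in \<open>S\<close>; then \<open>{v}\<close> is closed off and the atom \<open>K\<close>
        shrinks to the excluded \<open>{v}\<close>.\<close>
      assume e: "(K - {v}) \<inter> {x, y, z} = {}"
      have "q \<in> {v} \<union> S" if "{v, q} \<in> edges H" for q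
      proof -
        have "q \<in> K \<union> S" using closed_offD[OF cl that True] .
        then show ?thesis using that e v_edge_iff by blast
      qed
      then have "closed_off H S {v}" using v_notin_S verts_H by (simp add: closed_off_def)
      then have "K = {v}" using bridge_atom[OF b] True by blast
      then show False using b bridge_not_v by simp
    qed
    then show ?thesis using True by (auto simp: up_def)
  next
    case False
    then have "K \<inter> {x, y, z} = {}" using closed_v[OF cl] by blast
    then show ?thesis using False by (simp add: up_def)
  qed
qed

lemma bridge_down:
  assumes b: "bridge H S K"
  shows "bridge G S (K - {v})"
proof -
  have cl: "closed_off H S K" using b by (simp add: bridge_def)
  have "K - {v} \<noteq> {}" using b bridge_not_v unfolding bridge_def by (metis Diff_eq_empty_iff subset_singletonD)
  moreover have "P = {} \<or> P = K - {v}" if P: "closed_off G S P" "P \<subseteq> K - {v}" for P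
  proof -
    have vP: "v \<notin> P" using P by auto
    have "up P \<subseteq> K" using P(2) closed_v[OF cl] by (auto simp: up_def)
    then have "up P = {} \<or> up P = K" using bridge_atom[OF b closed_up[OF P(1)]] by simp
    then show ?thesis using vP by (auto simp: up_def split: if_splits)
  qed
  moreover have "\<exists>k\<in>K - {v}. {s, k} \<in> edges G" if s: "s \<in> S" for s
  proof -
    obtain k where k: "k \<in> K" "{s, k} \<in> edges H" using b s by (auto simp: bridge_def)
    have sv: "s \<noteq> v" using s v_notin_S by auto
    show ?thesis
    proof (cases "k = v")
      case True
      then have sx: "s \<in> {x, y, z}" using k v_edge_iff by (metis insert_commute)
      \<comment> \<open>The edge from \<open>s\<close> to \<open>v\<close> is absent in
        \<open>G\<close>; a corner in \<open>K\<close> takes over, joined to the corner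
        \<open>s\<close> by a side of the triangle.\<close>
      have "(K - {v}) \<inter> {x, y, z} \<noteq> {}"
        using up_down[OF b] k True by (auto simp: up_def split: if_splits)
      then obtain l where l: "l \<in> K - {v}" "l \<in> {x, y, z}" by blast
      have "l \<noteq> s" using l s cl by (auto simp: closed_off_def)
      then show ?thesis using triangle_edge[OF sx l(2)] l(1) by auto
    next
      case False
      then show ?thesis using k edge_H_iff sv by blast
    qed
  qed
  ultimately show ?thesis using closed_down[OF cl] by (auto simp: bridge_def)
qed

lemma bridge_up:
  assumes b: "bridge G S K"
  shows "bridge H S (up K)"
proof -
  have cl: "closed_off G S K" and ne: "K \<noteq> {}" using b by (auto simp: bridge_def)
  have vK: "v \<notin> K" and KS: "K \<inter> S = {}" using cl new by (auto simp: closed_off_def)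
  have "P = {} \<or> P = up K" if P: "closed_off H S P" "P \<subseteq> up K" for P
  proof -
    have "P - {v} \<subseteq> K" using P(2) by (auto simp: up_def split: if_splits)
    then consider "P - {v} = {}" | "P - {v} = K"
      using bridge_atom[OF b closed_down[OF P(1)]] by blast
    then show ?thesis
    proof cases
      case 1
      \<comment> \<open>Here \<open>P\<close> might still be \<open>{v}\<close>; but
        \<open>v\<close> enters \<open>up K\<close> only if a corner lies in \<open>K\<close>, and
        that neighbour of \<open>v\<close> would have to lie in \<open>P\<close> as well.\<close>
      have "v \<notin> P"
      proof
        assume vP: "v \<in> P"
        then have "K \<inter> {x, y, z} \<noteq> {}" using P(2) vK by (auto simp: up_def split: if_splits)
        then obtain q where q: "q \<in> K" "{v, q} \<in> edges H" using v_edge_iff by blast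
        then have "q \<in> P \<union> S" using closed_offD[OF P(1)] vP by blast
        then show False using q 1 vK KS by blast
      qed
      then show ?thesis using 1 by auto
    next
      case 2
      show ?thesis
      proof (cases "K \<inter> {x, y, z} = {}")
        case True
        then show ?thesis using 2 P(2) vK by (auto simp: up_def)
      next
        case False
        then have "v \<in> P" using closed_v[OF P(1)] 2 by blast
        then show ?thesis using False 2 by (auto simp: up_def)
      qed
    qed
  qed
  moreover have "\<exists>k\<in>up K. {s, k} \<in> edges H" if s: "s \<in> S" for s
  proof -
    obtain k where k: "k \<in> K" "{s, k} \<in> edges G" using b s by (auto simp: bridge_def)
    have sv: "s \<noteq> v" "k \<noteq> v" using s k v_notin_S vK by auto
    show ?thesis
    proof (cases "{s, k} \<subseteq> {x, y, z}")
      case True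
      then have "{s, v} \<in> edges H" using v_edge_iff by (auto simp: insert_commute)
      then show ?thesis using True k by (auto simp: up_def)
    next
      case False
      then show ?thesis using k edge_H_iff sv by (auto simp: up_def)
    qed
  qed
  moreover have "up K \<noteq> {}" using ne by (auto simp: up_def)
  ultimately show ?thesis using closed_up[OF cl] by (auto simp: bridge_def)
qed

lemma card_bridges: "card {K. bridge H S K} = card {K. bridge G S K}"
proof (rule bij_betw_same_card)
  have "up K - {v} = K" if "bridge G S K" for K
    using that new by (auto simp: bridge_def closed_off_def up_def)
  then show "bij_betw (\<lambda>K. K - {v}) {K. bridge H S K} {K. bridge G S K}"
    using up_down bridge_up bridge_down by (intro bij_betw_byWitness[where f' = up]) auto
qed

lemma simple_H: "simple_graph H"
  using triangle_Y_simple[OF simple] triangle new H unfolding triangle_Y_def by blast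

lemma frame_iff: "frame n c H S \<longleftrightarrow> frame n c G S"
  using card_bridges simple simple_H S by (auto simp: frame_def H)

end

lemma delta_wyeE:
  assumes "triangle_Y G H" "simple_graph G" "S \<subseteq> verts G" "card S \<noteq> 3"
  obtains x y z v where "delta_wye G H S x y z v"
  using assms unfolding triangle_Y_def delta_wye_def by blast

text \<open>Each bridge contains a neighbour of \<open>s\<close>, and neighbours from different
  bridges differ because bridges are disjoint.\<close>

lemma frame_degree:
  assumes F: "frame n c G S" and s: "s \<in> S"
  shows "c \<le> card (neighbours G s)"
proof -
  have sG: "simple_graph G" and c: "card {K. bridge G S K} = c" using F by (auto simp: frame_def)
  have "\<forall>K. bridge G S K \<longrightarrow> (\<exists>k\<in>K. {s, k} \<in> edges G)" using s by (auto simp: bridge_def)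
  then obtain k where k: "\<And>K. bridge G S K \<Longrightarrow> k K \<in> K \<and> {s, k K} \<in> edges G" by metis
  have "inj_on k {K. bridge G S K}"
  proof (rule inj_onI)
    fix K L assume KL: "K \<in> {K. bridge G S K}" "L \<in> {K. bridge G S K}" "k K = k L"
    then have "k K \<in> K \<inter> L" using k[of K] k[of L] by simp
    then show "K = L" using bridge_disjoint[of G S K L] KL by auto
  qed
  moreover have "k ` {K. bridge G S K} \<subseteq> neighbours G s" using k by (auto simp: neighbours_def)
  moreover have "finite (neighbours G s)"
    using sG by (intro finite_subset[of "neighbours G s" "verts G"])
      (auto simp: neighbours_def simple_graph_def)
  ultimately show ?thesis using c card_inj_on_le by metis
qed

lemma frame_triangle_Y:
  assumes "frame n c G S" "triangle_Y G H" "n \<noteq> 3"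
  shows "frame n c H S"
  using assms delta_wyeE[OF assms(2), of S] delta_wye.frame_iff unfolding frame_def by metis

text \<open>The vertex removed by the inverse move has degree three, whereas vertices of
  \<open>S\<close> have degree at least \<open>c \<ge> 4\<close>; hence it is not in
  \<open>S\<close>.\<close>

lemma frame_triangle_Y_rev:
  assumes F: "frame n c H S" and t: "triangle_Y G H" and s: "simple_graph G" and "n \<noteq> 3" "c \<ge> 4"
  shows "frame n c G S"
proof -
  \<comment> \<open>The locale is first entered with the empty set, because
    \<open>v \<notin> S\<close> must be known before it can be entered with
    \<open>S\<close>.\<close>
  obtain x y z v where d: "delta_wye G H {} x y z v"
    by (rule delta_wyeE[OF t s, of "{}"]) auto
  then have "card (neighbours H v) < 4"
    by (simp add: delta_wye.neighbours_v card_insert_if)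
  then have "v \<notin> S" using frame_degree[OF F] \<open>c \<ge> 4\<close> by fastforce
  then have "delta_wye G H S x y z v"
    using d F \<open>n \<noteq> 3\<close> by (auto simp: delta_wye_def frame_def)
  then show ?thesis using F delta_wye.frame_iff by metis
qed

lemma frame_move:
  assumes "frame n c G S" "move G H" "n \<noteq> 3" "c \<ge> 4"
  shows "frame n c H S"
  using assms frame_triangle_Y frame_triangle_Y_rev Y_triangle_iff_triangle_Y Y_triangle_simple
  unfolding frame_def by metis

subsection \<open>Full vertices\<close>

definition full_vertex :: "'a graph \<Rightarrow> 'a set \<Rightarrow> 'a \<Rightarrow> bool" where
  "full_vertex G S f \<longleftrightarrow> f \<in> verts G - S \<and> neighbours G f = S"

lemma bridge_singleton:
  assumes "simple_graph G" "bridge G S {f}"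
  shows "full_vertex G S f"
proof -
  have cl: "closed_off G S {f}" using assms(2) by (simp add: bridge_def)
  have "u \<in> S" if "{f, u} \<in> edges G" for u
    using closed_offD[OF cl that] simple_graphD(1)[OF assms(1) that] by auto
  moreover have "{f, s} \<in> edges G" if "s \<in> S" for s
    using that assms(2) by (auto simp: bridge_def insert_commute)
  ultimately show ?thesis using cl by (auto simp: full_vertex_def neighbours_def closed_off_def)
qed

lemma simple_graph_edgeE:
  assumes "simple_graph G" "e \<in> edges G" "p \<in> e"
  obtains q where "e = {p, q}"
proof -
  have "card e = 2" using assms by (simp add: simple_graph_def)
  then show ?thesis using assms(3) that by (auto simp: card_2_iff insert_commute)
qed

text \<open>One edge leads from \<open>K\<close> to each vertex of \<open>S\<close>. A bridge with
  several vertices has a further edge inside, since otherwise one of its vertices would be closed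
  off alone.\<close>

lemma bridge_edges:
  assumes s: "simple_graph G" and K: "bridge G S K" and n: "\<nexists>f. K = {f}"
    and S: "finite S"
  shows "card S + 1 \<le> card {e \<in> edges G. e \<inter> K \<noteq> {}}"
proof -
  have cl: "closed_off G S K" and ne: "K \<noteq> {}" using K by (auto simp: bridge_def)
  obtain f where f: "f \<in> K" using ne by auto
  then have "{f} \<noteq> K" using n by auto
  then have "\<not> closed_off G S {f}" using bridge_atom[OF K, of "{f}"] f by auto
  then obtain g where g: "{f, g} \<in> edges G" "g \<notin> S"
    using f cl by (auto simp: closed_off_def)
  then have gK: "g \<in> K" using closed_offD[OF cl g(1) f] by simp
  have "\<forall>t\<in>S. \<exists>k\<in>K. {t, k} \<in> edges G" using K by (simp add: bridge_def)
  then obtain k where k: "\<And>t. t \<in> S \<Longrightarrow> k t \<in> K \<and> {t, k t} \<in> edges G" by metis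
  have KS: "K \<inter> S = {}" using cl by (auto simp: closed_off_def)
  define E where "E = (\<lambda>t. {t, k t}) ` S"
  have "inj_on (\<lambda>t. {t, k t}) S"
    using k KS by (intro inj_onI) (auto simp: doubleton_eq_iff)
  then have "card E = card S" by (simp add: E_def card_image)
  moreover have "{f, g} \<notin> E" using f gK KS by (auto simp: E_def doubleton_eq_iff)
  ultimately have "card S + 1 = card (insert {f, g} E)" using S by (simp add: E_def)
  also have "\<dots> \<le> card {e \<in> edges G. e \<inter> K \<noteq> {}}"
    using f g(1) k finite_edges[OF s] by (intro card_mono) (auto simp: E_def)
  finally show ?thesis .
qed

text \<open>Pigeonhole: without a full vertex each of the \<open>c\<close> bridges is met by at
  least \<open>n + 1\<close> edges, and no edge meets two bridges.\<close>

lemma frame_full_vertex: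
  assumes F: "frame n c G S" and m: "card (edges G) < c * (n + 1)"
  obtains f where "full_vertex G S f"
proof (rule ccontr)
  assume "\<not> thesis"
  then have nf: "\<not> full_vertex G S f" for f using that by blast
  have s: "simple_graph G" and S: "S \<subseteq> verts G" "card S = n" and c: "card {K. bridge G S K} = c"
    using F by (auto simp: frame_def)
  have finS: "finite S" using s S by (auto simp: simple_graph_def intro: finite_subset)
  let ?E = "\<lambda>K. {e \<in> edges G. e \<inter> K \<noteq> {}}"
  have disj: "?E K \<inter> ?E L = {}" if KL: "bridge G S K" "bridge G S L" "K \<noteq> L" for K L
  proof (rule ccontr)
    assume "?E K \<inter> ?E L \<noteq> {}"
    then obtain e where e: "e \<in> edges G" "e \<inter> K \<noteq> {}" "e \<inter> L \<noteq> {}" by blast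
    then obtain p q where pq: "e = {p, q}" "p \<in> K"
      using simple_graph_edgeE[OF s e(1)] by (metis IntE ex_in_conv)
    have KL0: "K \<inter> L = {}" using bridge_disjoint[OF KL] .
    then have "q \<in> L" using e pq by auto
    moreover have "closed_off G S K" using KL(1) by (simp add: bridge_def)
    then have "q \<in> K \<union> S" using e(1) pq closed_offD by metis
    ultimately show False using KL0 KL(2) by (auto simp: bridge_def closed_off_def)
  qed
  have "c * (n + 1) \<le> (\<Sum>K\<in>{K. bridge G S K}. card (?E K))"
    using sum_bounded_below[of "{K. bridge G S K}" "n + 1" "\<lambda>K. card (?E K)"]
      bridge_edges[OF s _ _ finS] bridge_singleton[OF s] nf c S(2) by force
  also have "\<dots> = card (\<Union>K\<in>{K. bridge G S K}. ?E K)"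
    using disj finite_edges[OF s] finite_bridges[OF s] by (subst card_UN_disjoint) auto
  also have "\<dots> \<le> card (edges G)" using finite_edges[OF s] by (intro card_mono) auto
  finally show False using m by simp
qed

section \<open>Adding and deleting full vertices\<close>

definition add_full :: "'a set \<Rightarrow> 'a \<Rightarrow> 'a graph \<Rightarrow> 'a graph" where
  "add_full S f G = (insert f (verts G), edges G \<union> (\<lambda>s. {s, f}) ` S)"

definition del :: "'a \<Rightarrow> 'a graph \<Rightarrow> 'a graph" where
  "del f G = (verts G - {f}, {e \<in> edges G. f \<notin> e})"

lemma verts_add_full [simp]: "verts (add_full S f G) = insert f (verts G)"
  by (simp add: add_full_def)

lemma verts_del [simp]: "verts (del f G) = verts G - {f}"
  by (simp add: del_def)

lemma simple_add_full:
  "simple_graph G \<Longrightarrow> S \<subseteq> verts G \<Longrightarrow> f \<notin> verts G \<Longrightarrow> simple_graph (add_full S f G)"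
  by (auto simp: simple_graph_def add_full_def card_insert_if)

lemma simple_del: "simple_graph G \<Longrightarrow> simple_graph (del f G)"
  by (auto simp: simple_graph_def del_def)

lemma del_add_full:
  assumes "simple_graph G" "f \<notin> verts G"
  shows "del f (add_full S f G) = G"
proof -
  have "f \<notin> e" if "e \<in> edges G" for e using that assms by (auto simp: simple_graph_def)
  then have "{e \<in> edges G \<union> (\<lambda>s. {s, f}) ` S. f \<notin> e} = edges G" by auto
  then show ?thesis using assms(2) by (simp add: del_def add_full_def)
qed

lemma add_full_del:
  assumes s: "simple_graph G" and f: "full_vertex G S f"
  shows "add_full S f (del f G) = G"
proof -
  have "e \<in> (\<lambda>s. {s, f}) ` S" if e: "e \<in> edges G" "f \<in> e" for e
  proof -
    obtain u where "e = {f, u}" using simple_graph_edgeE[OF s e] .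
    then show ?thesis using f e by (auto simp: full_vertex_def neighbours_def)
  qed
  moreover have "{t, f} \<in> edges G" if "t \<in> S" for t
    using that f by (auto simp: full_vertex_def neighbours_def insert_commute)
  ultimately have "{e \<in> edges G. f \<notin> e} \<union> (\<lambda>s. {s, f}) ` S = edges G" by blast
  moreover have "insert f (verts G - {f}) = verts G" using f by (auto simp: full_vertex_def)
  ultimately show ?thesis by (simp add: del_def add_full_def)
qed

lemma full_add_full:
  assumes "simple_graph G" "S \<subseteq> verts G" "f \<notin> verts G"
  shows "full_vertex (add_full S f G) S f"
proof -
  have "{f, u} \<notin> edges G" for u using simple_graphD(2)[OF assms(1)] assms(3) by blast
  then have "neighbours (add_full S f G) f = S"
    using assms(2,3) by (auto simp: neighbours_def add_full_def doubleton_eq_iff)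
  then show ?thesis using assms by (auto simp: full_vertex_def)
qed

lemma add_full_map_graph:
  assumes "simple_graph G" "S \<subseteq> verts G" "f \<notin> verts G"
  shows "map_graph (h(f := g)) (add_full S f G) = add_full (h ` S) g (map_graph h G)"
proof -
  define k where "k = h(f := g)"
  have kf: "k f = g" by (simp add: k_def)
  have "map_graph k G = map_graph h G" using assms by (intro map_graph_cong) (auto simp: k_def)
  then have e: "k ` verts G = h ` verts G" "(`) k ` edges G = (`) h ` edges G"
    by (simp_all add: map_graph_def)
  have "k ` {t, f} = {h t, g}" if "t \<in> S" for t using that assms(2,3) by (auto simp: k_def)
  then have "(`) k ` (\<lambda>s. {s, f}) ` S = (\<lambda>s. {s, g}) ` h ` S"
    unfolding image_image by (intro image_cong) auto
  then show ?thesis unfolding k_def[symmetric] using e kf by (simp add: map_graph_def add_full_def image_Un)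
qed

lemma inj_on_fun_upd_insert:
  assumes "inj_on h V" "f \<notin> V" "g \<notin> h ` V"
  shows "inj_on (h(f := g)) (insert f V)"
  using assms by (auto simp: inj_on_def)

lemma triangle_Y_add_full:
  assumes s: "simple_graph G" and t: "triangle_Y G H" and S: "S \<subseteq> verts G" and f: "f \<notin> verts H"
  shows "triangle_Y (add_full S f G) (add_full S f H)"
proof -
  obtain x y z v where d: "delta_wye G H {} x y z v"
    by (rule delta_wyeE[OF t s, of "{}"]) auto
  then interpret delta_wye G H "{}" x y z v .
  have fn: "f \<noteq> x" "f \<noteq> y" "f \<noteq> z" "f \<noteq> v" "f \<notin> verts G" using xyz f verts_H by auto
  have "edges G \<union> F - {{x, y}, {y, z}, {z, x}} \<union> {{x, v}, {y, v}, {z, v}} =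
      (edges G - {{x, y}, {y, z}, {z, x}} \<union> {{x, v}, {y, v}, {z, v}}) \<union> F"
    if "F = (\<lambda>s. {s, f}) ` S" for F
  proof -
    have "F \<inter> {{x, y}, {y, z}, {z, x}} = {}" using fn that by (auto simp: doubleton_eq_iff)
    then show ?thesis by blast
  qed
  from this[OF refl] have "add_full S f H = (insert v (verts (add_full S f G)),
      edges (add_full S f G) - {{x, y}, {y, z}, {z, x}} \<union> {{x, v}, {y, v}, {z, v}})"
    by (simp add: add_full_def H insert_commute)
  moreover have "v \<notin> verts (add_full S f G)" using new fn by simp
  moreover have "{x, y} \<in> edges (add_full S f G)" "{y, z} \<in> edges (add_full S f G)"
    "{z, x} \<in> edges (add_full S f G)" using triangle by (simp_all add: add_full_def)
  ultimately show ?thesis unfolding triangle_Y_def by blast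
qed

text \<open>A full vertex of \<open>H\<close> has all its neighbours in \<open>S\<close>, so it is
  not adjacent to \<open>v\<close>, and by \<open>card S \<noteq> 3\<close> it is not
  \<open>v\<close> itself. Thus it takes no part in the move, which survives its deletion.\<close>

lemma (in delta_wye) full_vertex_down:
  assumes f: "full_vertex H S f"
  shows "full_vertex G S f" "triangle_Y (del f G) (del f H)"
proof -
  have fS: "f \<notin> S" "neighbours H f = S" "f \<in> verts H" using f by (auto simp: full_vertex_def)
  have "f \<noteq> v" using fS(2) neighbours_v S(2) xyz by auto
  moreover have "f \<notin> {x, y, z}"
  proof
    assume "f \<in> {x, y, z}"
    then have "{f, v} \<in> edges H" using v_edge_iff by (metis insert_commute)
    then show False using fS(2) v_notin_S by (auto simp: neighbours_def)
  qed
  ultimately have fn: "f \<noteq> x" "f \<noteq> y" "f \<noteq> z" "f \<noteq> v" by auto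
  have "{f, q} \<in> edges G \<longleftrightarrow> {f, q} \<in> edges H" for q
  proof (cases "q = v")
    case True
    then show ?thesis using v_no_edge v_edge_iff[of f] fn by (auto simp: insert_commute)
  next
    case False
    then show ?thesis using edge_H_iff fn by auto
  qed
  then show "full_vertex G S f"
    using fS fn verts_H by (auto simp: full_vertex_def neighbours_def)
  have "{e \<in> edges H. f \<notin> e} =
      {e \<in> edges G. f \<notin> e} - {{x, y}, {y, z}, {z, x}} \<union> {{x, v}, {y, v}, {z, v}}"
  proof -
    have *: "{e \<in> E - T \<union> Y. f \<notin> e} = {e \<in> E. f \<notin> e} - T \<union> Y" if "\<forall>e\<in>Y. f \<notin> e" for E T Y :: "'a set set"
      using that by blast
    show ?thesis unfolding H snd_conv by (rule *) (use fn in simp)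
  qed
  then have "del f H = (insert v (verts (del f G)),
      edges (del f G) - {{x, y}, {y, z}, {z, x}} \<union> {{x, v}, {y, v}, {z, v}})"
    using fn by (simp add: del_def verts_H insert_Diff_if)
  moreover have "v \<notin> verts (del f G)" using new by simp
  moreover have "{x, y} \<in> edges (del f G)" "{y, z} \<in> edges (del f G)" "{z, x} \<in> edges (del f G)"
    using triangle fn by (simp_all add: del_def)
  ultimately show "triangle_Y (del f G) (del f H)" unfolding triangle_Y_def by blast
qed

text \<open>Both graphs arise from the one without \<open>f\<close> and \<open>g\<close> by adding
  one full vertex, so renaming \<open>g\<close> to \<open>f\<close> maps one onto the other.\<close>

lemma twin_full_vertices:
  assumes s: "simple_graph G" and S: "S \<subseteq> verts G" and f: "full_vertex G S f" and g: "full_vertex G S g"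
  obtains h where "inj_on h (verts (del f G))" "h ` S = S" "map_graph h (del f G) = del g G"
proof (cases "f = g")
  case True
  then show ?thesis using that[of id] by simp
next
  case False
  let ?X = "del f (del g G)"
  have fg: "f \<in> verts G" "f \<notin> S" "g \<in> verts G" "g \<notin> S" using f g by (auto simp: full_vertex_def)
  have X: "?X = del g (del f G)" by (auto simp: del_def)
  have full: "full_vertex (del g G) S f" "full_vertex (del f G) S g"
    using False f g fg by (auto simp: full_vertex_def neighbours_def del_def)
  have "map_graph (id(g := f)) (add_full S g ?X) = add_full (id ` S) f (map_graph id ?X)"
    using S fg by (intro add_full_map_graph simple_del s) auto
  then have "map_graph (id(g := f)) (del f G) = del g G"
    using add_full_del[OF simple_del[OF s] full(1)] add_full_del[OF simple_del[OF s] full(2)]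
    by (simp add: X)
  moreover have "inj_on (id(g := f)) (verts (del f G))" by (auto simp: inj_on_def)
  moreover have "(id(g := f)) ` S = S" using fg by auto
  ultimately show ?thesis using that by blast
qed

subsection \<open>Cousins with a marked vertex set\<close>

text \<open>Isomorphisms may occur between moves, but only those that fix \<open>S\<close> as a set.
  So one \<open>S\<close> serves all these graphs while other vertices can be renamed.\<close>

inductive marked_cousin :: "nat set \<Rightarrow> nat graph \<Rightarrow> nat graph \<Rightarrow> bool" for S K where
  base: "marked_cousin S K K"
| step: "marked_cousin S K G \<Longrightarrow> move G H \<Longrightarrow> marked_cousin S K H"
| iso: "marked_cousin S K G \<Longrightarrow> inj_on h (verts G) \<Longrightarrow> h ` S = S \<Longrightarrow> marked_cousin S K (map_graph h G)"

lemma graph_iso_refl: "graph_iso G G"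
  by (auto simp: graph_iso_def intro!: exI[of _ id])

lemma cousin_graph_iso:
  assumes "cousin K G" "graph_iso G H"
  shows "cousin K H"
proof -
  obtain G' where "move\<^sup>*\<^sup>* K G'" "graph_iso G' G" using assms(1) by (auto simp: cousin_def)
  moreover have "graph_iso G' H" using calculation(2) assms(2) by (rule graph_iso_trans)
  ultimately show ?thesis unfolding cousin_def by blast
qed

lemma marked_cousin_cousin:
  assumes "marked_cousin S K G" "simple_graph K"
  shows "simple_graph G \<and> cousin K G"
  using assms
proof induction
  case base
  then show ?case using graph_iso_refl unfolding cousin_def by blast
next
  case (step G H)
  then show ?case using cousin_move move_simple by blast
next
  case (iso G h)
  have "graph_iso G (map_graph h G)" using iso.hyps by (auto simp: graph_iso_map_graph)
  moreover have "simple_graph G" "cousin K G" using iso.IH[OF iso.prems] by simp_all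
  ultimately show ?case
    using simple_map_graph[OF _ iso.hyps(2)] cousin_graph_iso by metis
qed

lemma moves_marked_cousin: "move\<^sup>*\<^sup>* K G \<Longrightarrow> marked_cousin S K G"
  by (induction rule: rtranclp_induct) (auto intro: marked_cousin.intros)

lemma graph_iso_card:
  assumes "simple_graph G" "graph_iso G H"
  shows "card (verts H) = card (verts G)" "card (edges H) = card (edges G)"
proof -
  obtain h where h: "inj_on h (verts G)" "H = map_graph h G"
    using assms(2) by (auto simp: graph_iso_map_graph)
  have "inj_on ((`) h) (edges G)"
    using inj_on_image_Pow[OF h(1)] edge_subset[OF assms(1)] by (auto intro: inj_on_subset)
  then show "card (verts H) = card (verts G)" "card (edges H) = card (edges G)"
    using h by (simp_all add: card_image)
qed

lemma move_card_edges: "simple_graph G \<Longrightarrow> move G H \<Longrightarrow> card (edges H) = card (edges G)"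
  using triangle_Y_invariants(1) Y_triangle_iff_triangle_Y Y_triangle_simple by metis

lemma marked_cousin_frame:
  assumes "marked_cousin S K G" "frame n c K S" "n \<noteq> 3" "c \<ge> 4"
  shows "frame n c G S \<and> card (edges G) = card (edges K)"
  using assms
proof induction
  case base
  then show ?case by simp
next
  case (step G H)
  then show ?case using frame_move move_card_edges unfolding frame_def by metis
next
  case (iso G h)
  then have F: "frame n c G S" by simp
  then have s: "simple_graph G" by (simp add: frame_def)
  have "graph_iso G (map_graph h G)" using iso.hyps by (auto simp: graph_iso_map_graph)
  then show ?case
    using iso graph_iso_card(2)[OF s] frame_map_graph[OF F iso.hyps(2)] by metis
qed

text \<open>Every step can be reversed, so a second frame of \<open>G\<close> is carried back along
  the derivation to a frame of \<open>K\<close>.\<close>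

lemma marked_cousin_frame_unique:
  assumes "marked_cousin S K G" "frame n c K S" "n \<noteq> 3" "c \<ge> 4"
    and "\<And>S'. frame n c K S' \<Longrightarrow> S' = S"
    and "frame n c G S'"
  shows "S' = S"
  using assms
proof (induction arbitrary: S')
  case base
  then show ?case by simp
next
  case (step G H)
  have F: "frame n c G S" using marked_cousin_frame step.hyps(1) step.prems by blast
  then have s: "simple_graph G" "simple_graph H"
    using move_simple[OF _ step.hyps(2)] by (auto simp: frame_def)
  then have "move H G"
    using step.hyps(2) Y_triangle_iff_triangle_Y[OF s] Y_triangle_iff_triangle_Y[OF s(2) s(1)] by blast
  then have "frame n c G S'" using frame_move step.prems by blast
  then show ?case using step by blast
next
  case (iso G h)
  let ?g = "inv_into (verts G) h"
  have F: "frame n c G S" using marked_cousin_frame iso.hyps(1) iso.prems by blast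
  then have s: "simple_graph G" by (simp add: frame_def)
  have "frame n c (map_graph ?g (map_graph h G)) (?g ` S')"
    using iso.prems(5) by (rule frame_map_graph) (auto intro: inj_on_inv_into)
  then have "frame n c G (?g ` S')" using map_graph_inv[OF s iso.hyps(2)] by simp
  then have "?g ` S' = S" using iso by blast
  moreover have "S' \<subseteq> h ` verts G" using iso.prems(5) by (simp add: frame_def)
  then have "h ` ?g ` S' = S'" by (intro image_inv_into_cancel[of h "verts G" "h ` verts G"]) auto
  ultimately show ?case using iso.hyps(3) by simp
qed

lemma fresh_vertex:
  fixes G :: "nat graph"
  assumes "simple_graph G"
  obtains g where "g \<notin> insert f (verts G)"
proof -
  have "finite (insert f (verts G))" using assms by (simp add: simple_graph_def)
  then show ?thesis using that ex_new_if_finite[OF infinite_UNIV_nat] by metis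
qed

lemma marked_cousin_add_full_rename:
  assumes "marked_cousin S K (add_full S g G)" "simple_graph G" "S \<subseteq> verts G"
    and "g \<notin> verts G" "f \<notin> verts G"
  shows "marked_cousin S K (add_full S f G)"
proof -
  have "map_graph (id(g := f)) (add_full S g G) = add_full (id ` S) f (map_graph id G)"
    using assms by (intro add_full_map_graph) auto
  then have e: "add_full S f G = map_graph (id(g := f)) (add_full S g G)"
    by simp
  have "(id(g := f)) ` S = S" using assms(3,4) by auto
  then show ?thesis unfolding e
    using assms inj_on_fun_upd_insert[of id "verts G" g f] by (intro marked_cousin.iso) simp_all
qed

text \<open>A full vertex does not disturb the moves, so the derivation of \<open>G\<close> from
  \<open>K\<close> can be repeated in its presence.\<close>

lemma marked_cousin_add_full:
  assumes "marked_cousin S K G" and K: "frame n c K S" "n \<noteq> 3" "c \<ge> 4"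
    and "\<And>f. f \<notin> verts K \<Longrightarrow> marked_cousin S K' (add_full S f K)"
    and "f \<notin> verts G"
  shows "marked_cousin S K' (add_full S f G)"
  using assms
proof (induction arbitrary: f)
  case base
  then show ?case by simp
next
  case (step G H)
  have "frame n c G S" "frame n c H S"
    using marked_cousin_frame marked_cousin.step step.hyps step.prems by blast+
  then have s: "simple_graph G" "simple_graph H" and S: "S \<subseteq> verts G" "S \<subseteq> verts H"
    by (auto simp: frame_def)
  show ?case
  proof (cases "triangle_Y G H")
    case True
    then have "f \<notin> verts G" using step.prems(5) by (auto simp: triangle_Y_def)
    then have "marked_cousin S K' (add_full S f G)" using step by blast
    then show ?thesis
      using triangle_Y_add_full[OF s(1) True S(1) step.prems(5)] marked_cousin.step by blast
  next
    case False
    then have t: "triangle_Y H G" using step.hyps(2) Y_triangle_iff_triangle_Y[OF s] by blast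
    have VH: "verts H \<subseteq> verts G" using t by (auto simp: triangle_Y_def)
    obtain g where g: "g \<notin> verts G" using fresh_vertex[OF s(1)] by auto
    then have gH: "g \<notin> verts H" using VH by auto
    have "triangle_Y (add_full S g H) (add_full S g G)"
      by (rule triangle_Y_add_full[OF s(2) t S(2) g])
    then have "Y_triangle (add_full S g G) (add_full S g H)"
      using Y_triangle_iff_triangle_Y[OF simple_add_full[OF s(1) S(1) g] simple_add_full[OF s(2) S(2) gH]]
      by simp
    moreover have "marked_cousin S K' (add_full S g G)" using step g by blast
    ultimately have "marked_cousin S K' (add_full S g H)" using marked_cousin.step by blast
    then show ?thesis
      by (rule marked_cousin_add_full_rename[OF _ s(2) S(2) gH step.prems(5)])
  qed
next
  case (iso G h)
  have "frame n c G S" using marked_cousin_frame iso.hyps iso.prems by blast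
  then have s: "simple_graph G" and S: "S \<subseteq> verts G" by (auto simp: frame_def)
  obtain g where g: "g \<notin> verts G" using fresh_vertex[OF s] by auto
  have "marked_cousin S K' (add_full S g G)" using iso g by blast
  moreover have "(h(g := f)) ` S = S" using iso.hyps(3) S g by (auto intro!: image_cong)
  moreover have "inj_on (h(g := f)) (insert g (verts G))"
    using iso.hyps(2) g iso.prems(5) by (intro inj_on_fun_upd_insert) auto
  ultimately have "marked_cousin S K' (map_graph (h(g := f)) (add_full S g G))"
    by (intro marked_cousin.iso) auto
  then show ?case unfolding add_full_map_graph[OF s S g] iso.hyps(3) .
qed

lemma marked_cousin_del_twin:
  assumes "marked_cousin S K (del f G)" "simple_graph G" "S \<subseteq> verts G"
    and "full_vertex G S f" "full_vertex G S g"
  shows "marked_cousin S K (del g G)"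
  using twin_full_vertices[OF assms(2-5)] marked_cousin.iso[OF assms(1)] by metis

text \<open>The full vertex varies along the derivation, since a move may use the current one as a
  corner. The edge bound supplies a suitable one at each step, and full vertices are interchangeable
  by an isomorphism fixing \<open>S\<close>.\<close>

lemma marked_cousin_del_full:
  assumes "marked_cousin S K G" and K: "frame n c K S" "n \<noteq> 3" "c \<ge> 4"
    and "card (edges K) < c * (n + 1)"
    and "full_vertex K S f0" "marked_cousin S K' (del f0 K)"
  shows "\<exists>f. full_vertex G S f \<and> marked_cousin S K' (del f G)"
  using assms
proof induction
  case base
  then show ?case by blast
next
  case (step G H)
  have F: "frame n c G S" "frame n c H S" and m: "card (edges G) < c * (n + 1)" "card (edges H) < c * (n + 1)"
    using marked_cousin_frame[of S K] marked_cousin.step step.hyps step.prems by metis+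
  then have s: "simple_graph G" "simple_graph H" and S: "S \<subseteq> verts G" "S \<subseteq> verts H" "card S = n"
    by (auto simp: frame_def)
  obtain f where f: "full_vertex G S f" "marked_cousin S K' (del f G)" using step by blast
  \<comment> \<open>The full vertex is taken from \<open>B\<close>, the graph containing the Y: it
    is then full in \<open>A\<close> too, whereas a full vertex of \<open>A\<close> may be a corner
    of the triangle.\<close>
  have *: "\<exists>g. full_vertex A S g \<and> full_vertex B S g \<and> triangle_Y (del g A) (del g B)"
    if AB: "triangle_Y A B" "frame n c A S" "frame n c B S" "card (edges B) < c * (n + 1)" for A B
  proof -
    obtain g where g: "full_vertex B S g" using frame_full_vertex[OF AB(3,4)] .
    have "simple_graph A" "S \<subseteq> verts A" "card S \<noteq> 3"
      using AB(2) step.prems(2) by (auto simp: frame_def)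
    from delta_wyeE[OF AB(1) this] obtain x y z v where "delta_wye A B S x y z v" .
    from delta_wye.full_vertex_down[OF this g] show ?thesis using g by metis
  qed
  have "\<exists>g. full_vertex G S g \<and> full_vertex H S g \<and> move (del g G) (del g H)"
  proof (cases "triangle_Y G H")
    case True
    then show ?thesis using * F m by blast
  next
    case False
    then have "triangle_Y H G" using step.hyps(2) Y_triangle_iff_triangle_Y[OF s] by blast
    then show ?thesis
      using *[OF _ F(2,1) m(1)] Y_triangle_iff_triangle_Y[OF simple_del[OF s(1)] simple_del[OF s(2)]]
      by blast
  qed
  then obtain g where g: "full_vertex G S g" "full_vertex H S g" "move (del g G) (del g H)" by blast
  have "marked_cousin S K' (del g G)"
    by (rule marked_cousin_del_twin[OF f(2) s(1) S(1) f(1) g(1)])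
  then show ?case using g(2,3) marked_cousin.step by blast
next
  case (iso G h)
  have "frame n c G S" using marked_cousin_frame iso.hyps iso.prems by blast
  then have s: "simple_graph G" and S: "S \<subseteq> verts G" by (auto simp: frame_def)
  obtain f where f: "full_vertex G S f" "marked_cousin S K' (del f G)" using iso by blast
  let ?D = "del f G"
  have fV: "f \<in> verts G" "f \<notin> S" using f(1) by (auto simp: full_vertex_def)
  have D: "simple_graph ?D" "S \<subseteq> verts ?D" "f \<notin> verts ?D" using simple_del[OF s] S fV by auto
  have i: "inj_on h (verts ?D)" using iso.hyps(2) by (auto intro: inj_on_subset)
  have hf: "h f \<notin> verts (map_graph h ?D)" using iso.hyps(2) fV by (auto simp: inj_on_def)
  have "map_graph (h(f := h f)) (add_full S f ?D) = add_full (h ` S) (h f) (map_graph h ?D)"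
    by (rule add_full_map_graph[OF D])
  then have e: "map_graph h G = add_full S (h f) (map_graph h ?D)"
    using add_full_del[OF s f(1)] iso.hyps(3) by simp
  have S': "S \<subseteq> verts (map_graph h ?D)" using image_mono[OF D(2), of h] iso.hyps(3) by simp
  note sD = simple_map_graph[OF D(1) i]
  have "full_vertex (map_graph h G) S (h f)"
    unfolding e by (rule full_add_full[OF sD S' hf])
  moreover have "del (h f) (map_graph h G) = map_graph h ?D"
    unfolding e by (rule del_add_full[OF sD hf])
  then have "marked_cousin S K' (del (h f) (map_graph h G))"
    using marked_cousin.iso[OF f(2) i iso.hyps(3)] by simp
  ultimately show ?case by blast
qed

subsection \<open>Complete tripartite graphs\<close>

definition part :: "nat \<Rightarrow> nat \<Rightarrow> nat \<Rightarrow> nat" where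
  "part a b i = (if i < a then 0 else if i < a + b then 1 else 2)"

lemma verts_complete_tripartite [simp]: "verts (complete_tripartite a b c) = {0..<a+b+c}"
  by (simp add: complete_tripartite_def)

lemma edge_complete_tripartite:
  "{p, q} \<in> edges (complete_tripartite a b c) \<longleftrightarrow>
     p < a + b + c \<and> q < a + b + c \<and> part a b p \<noteq> part a b q" 
proof -
  have *: "{p, q} \<in> {{i, j} |i j. i \<in> I \<and> j \<in> J} \<longleftrightarrow> p \<in> I \<and> q \<in> J \<or> q \<in> I \<and> p \<in> J"
    for I J :: "nat set"
    by (auto simp: doubleton_eq_iff)
  show ?thesis
    unfolding complete_tripartite_def snd_conv Un_iff * by (auto simp: part_def)
qed

lemma card_edges_complete_tripartite:
  "card (edges (complete_tripartite a b c)) \<le> a * b + (a + b) * c"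
proof -
  have *: "card {{i, j} |i j. i \<in> I \<and> j \<in> J} \<le> card I * card J"
    if "finite I" "finite J" for I J :: "nat set"
  proof -
    have "{{i, j} |i j. i \<in> I \<and> j \<in> J} = (\<lambda>(i, j). {i, j}) ` (I \<times> J)" by auto
    then show ?thesis using that card_image_le[of "I \<times> J" "\<lambda>(i, j). {i, j}"] by (simp add: card_cartesian_product)
  qed
  let ?E = "\<lambda>I J. {{i, j} |i j. i \<in> I \<and> j \<in> J} :: nat set set"
  have "card (edges (complete_tripartite a b c)) \<le> card (?E {0..<a} {a..<a+b})
      + card (?E {0..<a} {a+b..<a+b+c}) + card (?E {a..<a+b} {a+b..<a+b+c})"
    unfolding complete_tripartite_def snd_conv
    by (meson add_right_mono card_Un_le order_trans)
  also have "\<dots> \<le> a * b + a * c + b * c"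
    using *[of "{0..<a}" "{a..<a+b}"] *[of "{0..<a}" "{a+b..<a+b+c}"]
      *[of "{a..<a+b}" "{a+b..<a+b+c}"] by simp
  finally show ?thesis by (simp add: algebra_simps)
qed

text \<open>Removing \<open>V - P\<close> leaves the independent part \<open>P\<close>, each vertex
  of which is a bridge by itself. The general \<open>t\<close> yields both
  \<open>A \<union> B\<close> and \<open>A \<union> C\<close>.\<close>

lemma frame_complete_tripartite:
  fixes a b c t :: nat
  defines "V \<equiv> {0..<a+b+c}"
  defines "P \<equiv> {i \<in> V. part a b i = t}"
  shows "frame (card (V - P)) (card P) (complete_tripartite a b c) (V - P)"
proof -
  let ?K = "complete_tripartite a b c"
  note edge = edge_complete_tripartite[of _ _ a b c]
  have cl: "closed_off ?K (V - P) Q" if "Q \<subseteq> P" for Q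
    using that by (auto simp: closed_off_def edge V_def P_def)
  have "bridge ?K (V - P) {p}" if "p \<in> P" for p
    using that cl[of "{p}"] unfolding bridge_def by (auto simp: edge V_def P_def)
  moreover have "\<exists>p\<in>P. Q = {p}" if Q: "bridge ?K (V - P) Q" for Q
  proof -
    have QP: "Q \<subseteq> P" "Q \<noteq> {}" using Q by (auto simp: bridge_def closed_off_def V_def)
    then obtain p where p: "p \<in> Q" by auto
    then have "{p} = Q" using bridge_atom[OF Q cl, of "{p}"] QP by auto
    then show ?thesis using p QP by blast
  qed
  ultimately have "{Q. bridge ?K (V - P) Q} = (\<lambda>p. {p}) ` P" by blast
  moreover have "card ((\<lambda>p. {p}) ` P) = card P" by (intro card_image) (simp add: inj_on_def)
  ultimately show ?thesis
    using simple_complete_tripartite by (auto simp: frame_def V_def)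
qed

lemma frame_AB: "frame (a + b) c (complete_tripartite a b c) {0..<a+b}"
proof -
  have "{i \<in> {0..<a+b+c}. part a b i = 2} = {a+b..<a+b+c}"
    by (auto simp: part_def split: if_splits)
  moreover have "{0..<a+b+c} - {a+b..<a+b+c} = {0..<a+b}" by auto
  ultimately show ?thesis using frame_complete_tripartite[of a b c 2] by simp
qed

text \<open>Vertices \<open>q\<close>, \<open>r\<close> of different bridges are not adjacent, hence
  in one part, and any vertex of another part is adjacent to both, hence in \<open>S\<close>. So the
  complement of \<open>S\<close>, of size \<open>c\<close>, fits into one part, and the size
  conditions leave only the third.\<close>

lemma frame_complete_tripartite_unique:
  assumes F: "frame (a + b) c (complete_tripartite a b c) S"
    and c: "2 \<le> c" "a * b \<le> c" "\<not> (a = 1 \<and> c = b)" and ab: "1 \<le> a" "a \<le> b"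
  shows "S = {0..<a+b}"
proof -
  let ?K = "complete_tripartite a b c" and ?V = "{0..<a+b+c}"
  note edge = edge_complete_tripartite[of _ _ a b c]
  have S: "S \<subseteq> ?V" "card S = a + b" and B: "card {Q. bridge ?K S Q} = c"
    using F by (auto simp: frame_def)
  have "\<not> card {Q. bridge ?K S Q} \<le> Suc 0" using B c by simp
  moreover have "finite {Q. bridge ?K S Q}" by (rule finite_bridges[OF simple_complete_tripartite])
  ultimately obtain Q R where QR: "bridge ?K S Q" "bridge ?K S R" "Q \<noteq> R"
    by (auto simp: card_le_Suc0_iff_eq)
  have disj: "Q \<inter> R = {}" by (rule bridge_disjoint[OF QR])
  have cQ: "closed_off ?K S Q" and cR: "closed_off ?K S R" using QR by (auto simp: bridge_def)
  obtain q r where qr: "q \<in> Q" "r \<in> R" using QR by (auto simp: bridge_def)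
  have V: "q < a + b + c" "q \<notin> S" "r < a + b + c" "r \<notin> S"
    using qr cQ cR by (auto simp: closed_off_def)
  have "part a b q = part a b r"
    using closed_offD[OF cQ _ qr(1), of r] edge[of q r] V qr disj by auto
  moreover have "part a b u = part a b q" if u: "u \<in> ?V - S" for u
  proof (rule ccontr)
    assume "part a b u \<noteq> part a b q"
    then have "{q, u} \<in> edges ?K" "{r, u} \<in> edges ?K" using u V calculation by (auto simp: edge)
    then have "u \<in> Q" "u \<in> R" using closed_offD[OF cQ _ qr(1)] closed_offD[OF cR _ qr(2)] u by blast+
    then show False using disj by blast
  qed
  ultimately have sub: "?V - S \<subseteq> {i \<in> ?V. part a b i = part a b q}" by auto
  have cVS: "card (?V - S) = c" using S by (simp add: card_Diff_subset finite_subset)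
  consider "part a b q = 0" | "part a b q = 1" | "part a b q = 2"
    unfolding part_def by presburger
  then show ?thesis
  proof cases
    case 1
    then have "?V - S \<subseteq> {0..<a}" using sub by (auto simp: part_def split: if_splits)
    then have "c \<le> a" using card_mono[of "{0..<a}" "?V - S"] cVS by simp
    moreover have "a \<le> a * b" using ab by simp
    ultimately have "a * b = a" "c = a" using c by linarith+
    then show ?thesis using ab c by auto
  next
    case 2
    then have "?V - S \<subseteq> {a..<a+b}" using sub by (auto simp: part_def split: if_splits)
    then have "c \<le> b" using card_mono[of "{a..<a+b}" "?V - S"] cVS by simp
    \<comment> \<open>The chain \<open>c \<le> b \<le> a * b \<le> c\<close> forces
      \<open>a = 1\<close> and \<open>c = b\<close>, the excluded case in which
      \<open>A \<union> C\<close> is a frame of the same kind.\<close>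
    moreover have "b \<le> a * b" using ab by simp
    ultimately have "a * b = b" "c = b" using c by linarith+
    then show ?thesis using ab c by auto
  next
    case 3
    then have "?V - S \<subseteq> {a+b..<a+b+c}" using sub by (auto simp: part_def split: if_splits)
    then have "?V - S = {a+b..<a+b+c}" using cVS by (intro card_subset_eq) auto
    moreover have "?V - (?V - S) = S" using S by auto
    moreover have "?V - {a+b..<a+b+c} = {0..<a+b}" by auto
    ultimately show ?thesis by metis
  qed
qed

lemma complete_tripartite_Suc:
  "complete_tripartite a b (Suc c) = add_full {0..<a+b} (a + b + c) (complete_tripartite a b c)"
proof -
  let ?E = "edges (complete_tripartite a b c)"
  let ?E' = "edges (complete_tripartite a b (Suc c))" and ?F = "?E \<union> (\<lambda>s. {s, a + b + c}) ` {0..<a+b}"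
  have pair: "{p, q} \<in> ?E' \<longleftrightarrow> {p, q} \<in> ?F" for p q
    unfolding Un_iff edge_complete_tripartite
    by (auto simp: doubleton_eq_iff part_def image_iff less_Suc_eq split: if_splits)
  have "?E' = ?F"
  proof (rule set_eqI)
    fix e
    have "\<exists>p q. e = {p, q}" if "e \<in> ?E' \<or> e \<in> ?F"
      using that by (auto simp: complete_tripartite_def)
    then show "e \<in> ?E' \<longleftrightarrow> e \<in> ?F" using pair by metis
  qed
  moreover have "{0..<a+b+Suc c} = insert (a+b+c) {0..<a+b+c}" by auto
  ultimately show ?thesis
    by (metis add_full_def prod.collapse verts_complete_tripartite)
qed

section \<open>Isomorphism classes and the step from \<open>c\<close> to
  \<open>c + 1\<close>\<close>

definition cls :: "nat graph \<Rightarrow> nat graph set" where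
  "cls G = iso_rel `` {G}"

lemma cls_eq_iff:
  assumes "simple_graph G" "simple_graph H"
  shows "cls G = cls H \<longleftrightarrow> graph_iso G H"
proof -
  have "cls G = cls H \<longleftrightarrow> (G, H) \<in> iso_rel"
    unfolding cls_def using assms by (intro eq_equiv_class_iff[OF iso_rel_equiv]) auto
  then show ?thesis using assms by (simp add: iso_rel_def)
qed

text \<open>Restricting to isomorphisms that fix \<open>S\<close> loses no class: a cousin is
  isomorphic to a graph reached by moves alone, which is a marked cousin for every
  \<open>S\<close>.\<close>

lemma family_marked_cousins:
  assumes "simple_graph K"
  shows "family K = cls ` {G. marked_cousin S K G}"
proof
  show "cls ` {G. marked_cousin S K G} \<subseteq> family K"
    using marked_cousin_cousin[OF _ assms] by (auto simp: family_def quotient_def cls_def)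
  show "family K \<subseteq> cls ` {G. marked_cousin S K G}"
  proof
    fix C assume "C \<in> family K"
    then obtain H where H: "C = cls H" "simple_graph H" "cousin K H"
      by (auto simp: family_def quotient_def cls_def)
    then obtain G where G: "move\<^sup>*\<^sup>* K G" "graph_iso G H" by (auto simp: cousin_def)
    then have "cls G = C" using H cls_eq_iff moves_simple[OF G(1) assms] by blast
    then show "C \<in> cls ` {G. marked_cousin S K G}" using moves_marked_cousin[OF G(1)] by blast
  qed
qed

text \<open>The last hypothesis covers the case in which an isomorphism of cousins may exchange the
  parts \<open>B\<close> and \<open>C\<close>.\<close>

lemma card_family_Suc:
  fixes a b c :: nat
  assumes ab: "1 \<le> a" "a \<le> b" "(a, b) \<noteq> (1, 2)" and c: "4 \<le> c" "a * b \<le> c"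
    and symmetric_case: "\<And>G H. a = 1 \<Longrightarrow> c = b \<Longrightarrow>
      marked_cousin {0..<a+b} (complete_tripartite a b (Suc c)) G \<Longrightarrow>
      marked_cousin {0..<a+b} (complete_tripartite a b (Suc c)) H \<Longrightarrow>
      card (verts G) = card (verts H) \<Longrightarrow> graph_iso G H"
  shows "card (family (complete_tripartite a b c)) = card (family (complete_tripartite a b (Suc c)))"
proof -
  define S where "S = {0..<a+b}"
  define K where "K = complete_tripartite a b c"
  define K' where "K' = complete_tripartite a b (Suc c)"
  have ab3: "a + b \<noteq> 3" using ab by auto
  have sK: "simple_graph K" "simple_graph K'"
    by (simp_all add: K_def K'_def simple_complete_tripartite)
  have F: "frame (a + b) c K S" "frame (a + b) (Suc c) K' S"
    unfolding K_def K'_def S_def by (rule frame_AB)+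
  have c': "4 \<le> Suc c" using c by simp
  have frames: "simple_graph G" "S \<subseteq> verts G" if "marked_cousin S K G" for G
    using marked_cousin_frame[OF that F(1) ab3 c(1)] by (auto simp: frame_def)
  have frames': "frame (a + b) (Suc c) G S" "simple_graph G" "S \<subseteq> verts G"
    if "marked_cousin S K' G" for G
    using marked_cousin_frame[OF that F(2) ab3 c'] by (auto simp: frame_def)
  have new: "a + b + c \<notin> verts K" and SV: "S \<subseteq> verts K" by (auto simp: K_def S_def)
  have K': "K' = add_full S (a + b + c) K"
    unfolding K_def K'_def S_def by (rule complete_tripartite_Suc)
  have add: "marked_cousin S K' (add_full S f G)" if "marked_cousin S K G" "f \<notin> verts G" for f G
  proof (rule marked_cousin_add_full[OF that(1) F(1) ab3 c(1) _ that(2)])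
    fix g assume "g \<notin> verts K"
    moreover have "marked_cousin S K' (add_full S (a + b + c) K)"
      using marked_cousin.base[of S K'] by (simp add: K')
    ultimately show "marked_cousin S K' (add_full S g K)"
      using marked_cousin_add_full_rename[OF _ sK(1) SV new] by blast
  qed
  have del: "\<exists>f. full_vertex G S f \<and> marked_cousin S K (del f G)" if "marked_cousin S K' G" for G
  proof (rule marked_cousin_del_full[OF that F(2) ab3 c'])
    have "card (edges K') \<le> a * b + (a + b) * Suc c"
      unfolding K'_def by (rule card_edges_complete_tripartite)
    \<comment> \<open>Strictness comes from \<open>a * b \<le> c < Suc c\<close>.\<close>
    also have "\<dots> < Suc c * (a + b + 1)" using c by (simp add: algebra_simps)
    finally show "card (edges K') < Suc c * (a + b + 1)" .
    show "full_vertex K' S (a + b + c)" unfolding K' by (rule full_add_full[OF sK(1) SV new])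
    show "marked_cousin S K (del (a + b + c) K')"
      using marked_cousin.base by (simp add: K' del_add_full[OF sK(1) new])
  qed
  \<comment> \<open>The image of a frame is a frame, and there is only one. The number
    \<open>n\<close> is left open because both \<open>c\<close> and \<open>Suc c\<close> are
    needed.\<close>
  have preserve: "h ` S = S"
    if "marked_cousin S (complete_tripartite a b n) G" "marked_cousin S (complete_tripartite a b n) H"
      "inj_on h (verts G)" "H = map_graph h G" "c \<le> n" "\<not> (a = 1 \<and> n = b)" for n h G H
  proof -
    have n: "4 \<le> n" "a * b \<le> n" "2 \<le> n" using c that(5) by auto
    have Fn: "frame (a + b) n (complete_tripartite a b n) S" unfolding S_def by (rule frame_AB)
    have "frame (a + b) n G S" using marked_cousin_frame[OF that(1) Fn ab3 n(1)] by simp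
    then have "frame (a + b) n H (h ` S)" unfolding that(4) using that(3) by (rule frame_map_graph)
    then show ?thesis
    proof (rule marked_cousin_frame_unique[OF that(2) Fn ab3 n(1), rotated])
      show "S' = S" if "frame (a + b) n (complete_tripartite a b n) S'" for S'
        unfolding S_def by (rule frame_complete_tripartite_unique[OF that n(3,2) \<open>\<not> (a = 1 \<and> n = b)\<close> ab(1,2)])
    qed
  qed
  \<comment> \<open>Adding a full vertex is treated as a relation on classes, since it depends on
    representatives; injectivity in each direction gives one of the two inequalities.\<close>
  define r where "r C D \<longleftrightarrow> (\<exists>G f. marked_cousin S K G \<and> f \<notin> verts G \<and>
      C = cls G \<and> D = cls (add_full S f G))" for C D
  have fam: "family K = cls ` {G. marked_cousin S K G}" "family K' = cls ` {G. marked_cousin S K' G}"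
    by (rule family_marked_cousins[OF sK(1)], rule family_marked_cousins[OF sK(2)])
  have fin: "finite (family K)" "finite (family K')" using sK finite_family by blast+
  have "card (family K) \<le> card (family K')"
  proof (rule card_le_if_inj_on_rel[where r = r, OF fin(2)])
    fix C assume "C \<in> family K"
    then obtain G where G: "marked_cousin S K G" "C = cls G" using fam by auto
    obtain f where "f \<notin> verts G" using fresh_vertex[OF frames(1)[OF G(1)]] by auto
    then show "\<exists>D. D \<in> family K' \<and> r C D" using G add fam unfolding r_def by blast
  next
    fix C1 C2 D assume "r C1 D" "r C2 D"
    then obtain G1 f1 G2 f2 where 1: "marked_cousin S K G1" "f1 \<notin> verts G1" "C1 = cls G1"
        "D = cls (add_full S f1 G1)"
      and 2: "marked_cousin S K G2" "f2 \<notin> verts G2" "C2 = cls G2" "D = cls (add_full S f2 G2)"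
      unfolding r_def by blast
    note s = frames(1)[OF 1(1)] frames(1)[OF 2(1)] and SS = frames(2)[OF 1(1)] frames(2)[OF 2(1)]
    let ?H1 = "add_full S f1 G1" and ?H2 = "add_full S f2 G2"
    have m: "marked_cousin S K' ?H1" "marked_cousin S K' ?H2" using add 1 2 by auto
    have "graph_iso ?H1 ?H2" using 1(4) 2(4) cls_eq_iff frames'(2) m by metis
    then obtain h where h: "inj_on h (verts ?H1)" "?H2 = map_graph h ?H1"
      by (auto simp: graph_iso_map_graph)
    \<comment> \<open>For \<open>a = 1\<close> one has \<open>b = a * b \<le> c\<close>, so in the
      larger graph \<open>B\<close> and \<open>C\<close> have different sizes and
      \<open>preserve\<close> applies.\<close>
    have "a = 1 \<Longrightarrow> Suc c \<noteq> b" using c by auto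
    then have hS: "h ` S = S"
      using preserve[OF m[unfolded K'_def] h] by auto
    have "map_graph (h(f1 := h f1)) ?H1 = add_full (h ` S) (h f1) (map_graph h G1)"
      by (rule add_full_map_graph[OF s(1) SS(1) 1(2)])
    then have H2: "?H2 = add_full S (h f1) (map_graph h G1)" using h(2) hS by simp
    have i: "inj_on h (verts G1)" and hf: "h f1 \<notin> verts (map_graph h G1)"
      using h(1) 1(2) by (auto simp: inj_on_def)
    note s1 = simple_map_graph[OF s(1) i]
    have S1: "S \<subseteq> verts (map_graph h G1)" using image_mono[OF SS(1), of h] hS by simp
    \<comment> \<open>Both \<open>h f1\<close> and \<open>f2\<close> are full in \<open>?H2\<close>,
      so deleting one or the other leaves isomorphic graphs, namely \<open>map_graph h G1\<close>
      and \<open>G2\<close>.\<close>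
    have full: "full_vertex ?H2 S (h f1)" unfolding H2 by (rule full_add_full[OF s1 S1 hf])
    have full2: "full_vertex ?H2 S f2" by (rule full_add_full[OF s(2) SS(2) 2(2)])
    obtain g where g: "inj_on g (verts (del (h f1) ?H2))"
        "map_graph g (del (h f1) ?H2) = del f2 ?H2"
      using twin_full_vertices[OF frames'(2,3)[OF m(2)] full full2] by metis
    have d: "del (h f1) ?H2 = map_graph h G1" unfolding H2 by (rule del_add_full[OF s1 hf])
    have "del f2 ?H2 = G2" by (rule del_add_full[OF s(2) 2(2)])
    then have "graph_iso (map_graph h G1) G2" using g unfolding graph_iso_map_graph d by metis
    moreover have "graph_iso G1 (map_graph h G1)" using i by (auto simp: graph_iso_map_graph)
    ultimately have "graph_iso G1 G2" using graph_iso_trans by blast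
    then show "C1 = C2" using 1(3) 2(3) cls_eq_iff[OF s] by simp
  qed
  moreover have "card (family K') \<le> card (family K)"
  proof (rule card_le_if_inj_on_rel[where r = "\<lambda>D C. r C D", OF fin(1)])
    fix D assume "D \<in> family K'"
    then obtain H where H: "marked_cousin S K' H" "D = cls H" using fam by auto
    obtain f where f: "full_vertex H S f" "marked_cousin S K (del f H)" using del[OF H(1)] by blast
    have "add_full S f (del f H) = H" by (rule add_full_del[OF frames'(2)[OF H(1)] f(1)])
    then have "r (cls (del f H)) D" unfolding r_def using f(2) H(2)
      by (intro exI[of _ "del f H"] exI[of _ f]) simp
    then show "\<exists>C. C \<in> family K \<and> r C D" using f(2) fam by blast
  next
    fix D1 D2 C assume "r C D1" "r C D2"
    then obtain G1 f1 G2 f2 where 1: "marked_cousin S K G1" "f1 \<notin> verts G1" "C = cls G1"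
        "D1 = cls (add_full S f1 G1)"
      and 2: "marked_cousin S K G2" "f2 \<notin> verts G2" "C = cls G2" "D2 = cls (add_full S f2 G2)"
      unfolding r_def by blast
    note s = frames(1)[OF 1(1)] frames(1)[OF 2(1)] and SS = frames(2)[OF 1(1)] frames(2)[OF 2(1)]
    let ?H1 = "add_full S f1 G1" and ?H2 = "add_full S f2 G2"
    have m: "marked_cousin S K' ?H1" "marked_cousin S K' ?H2" using add 1 2 by auto
    have iso: "graph_iso G1 G2" using 1(3) 2(3) cls_eq_iff[OF s] by simp
    then obtain h where h: "inj_on h (verts G1)" "G2 = map_graph h G1"
      by (auto simp: graph_iso_map_graph)
    have "graph_iso ?H1 ?H2"
    proof (cases "a = 1 \<and> c = b")
      \<comment> \<open>Here \<open>h\<close> may exchange the parts \<open>B\<close> and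
        \<open>C\<close> and so move \<open>S\<close>; the number of vertices is used
        instead.\<close>
      case True
      have "card (verts ?H1) = card (verts ?H2)"
        using graph_iso_card(1)[OF s(1) iso] 1(2) 2(2) s by (simp add: simple_graph_def)
      then show ?thesis
        using symmetric_case[OF _ _ m[unfolded K'_def S_def]] True by (simp add: S_def)
    next
      case False
      have "h ` S = S" using preserve[OF 1(1)[unfolded K_def] 2(1)[unfolded K_def] h _ False] by simp
      then have "?H2 = map_graph (h(f1 := f2)) ?H1"
        using add_full_map_graph[OF s(1) SS(1) 1(2), of h f2] h(2) by simp
      moreover have "inj_on (h(f1 := f2)) (verts ?H1)"
        using inj_on_fun_upd_insert[OF h(1) 1(2)] 2(2) h(2) by simp
      ultimately show ?thesis unfolding graph_iso_map_graph by blast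
    qed
    then show "D1 = D2" using 1(4) 2(4) cls_eq_iff frames'(2) m by metis
  qed
  ultimately show ?thesis by (simp add: K_def K'_def)
qed

subsection \<open>The cousins of \<open>K_{1,b,c}\<close>\<close>

definition pairs :: "'a set \<Rightarrow> 'a set set" where
  "pairs T = {{p, q} |p q. p \<in> T \<and> q \<in> T \<and> p \<noteq> q}"

lemma pairs_triple: "x \<noteq> y \<Longrightarrow> y \<noteq> z \<Longrightarrow> z \<noteq> x \<Longrightarrow> pairs {x, y, z} = {{x, y}, {y, z}, {z, x}}"
  unfolding pairs_def by (auto simp: insert_commute)

lemma in_pairs_iff: "{p, q} \<in> pairs T \<longleftrightarrow> p \<in> T \<and> q \<in> T \<and> p \<noteq> q"
  by (auto simp: pairs_def doubleton_eq_iff)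

text \<open>\<open>wyes K Y \<tau>\<close> results from \<open>K\<close> by Triangle-Y moves on the triangles \<open>\<tau> y\<close>, with new vertices \<open>y \<in> Y\<close>.\<close>

definition wyes :: "'a graph \<Rightarrow> 'a set \<Rightarrow> ('a \<Rightarrow> 'a set) \<Rightarrow> 'a graph" where
  "wyes K Y \<tau> = (verts K \<union> Y,
     (edges K - (\<Union>y\<in>Y. pairs (\<tau> y))) \<union> (\<Union>y\<in>Y. (\<lambda>s. {s, y}) ` \<tau> y))"

text \<open>Part \<open>A\<close> is \<open>{0}\<close>, so all triangles contain \<open>0\<close>,
  and two edge-disjoint ones share nothing else. The remaining corners form a matching between
  \<open>B\<close> and \<open>C\<close>.\<close>

definition transversals :: "nat \<Rightarrow> nat \<Rightarrow> nat set \<Rightarrow> (nat \<Rightarrow> nat set) \<Rightarrow> bool" where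
  "transversals b c Y \<tau> \<longleftrightarrow> finite Y \<and> Y \<inter> {0..<1+b+c} = {} \<and>
     (\<forall>y\<in>Y. \<exists>p\<in>{1..<1+b}. \<exists>q\<in>{1+b..<1+b+c}. \<tau> y = {0, p, q}) \<and>
     (\<forall>y\<in>Y. \<forall>y'\<in>Y. y \<noteq> y' \<longrightarrow> \<tau> y \<inter> \<tau> y' = {0})"

lemma transversal_tripleE:
  assumes "transversals b c Y \<tau>" "y \<in> Y"
  obtains p q where "p \<in> {1..<1+b}" "q \<in> {1+b..<1+b+c}" "\<tau> y = {0, p, q}"
proof -
  have "\<forall>y\<in>Y. \<exists>p\<in>{1..<1+b}. \<exists>q\<in>{1+b..<1+b+c}. \<tau> y = {0, p, q}"
    using assms(1) unfolding transversals_def by (elim conjE)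
  from bspec[OF this assms(2)] show ?thesis using that by blast
qed

lemma transversal_disjoint:
  "transversals b c Y \<tau> \<Longrightarrow> y \<in> Y \<Longrightarrow> y' \<in> Y \<Longrightarrow> y \<noteq> y' \<Longrightarrow> \<tau> y \<inter> \<tau> y' = {0}"
  by (simp only: transversals_def) simp

lemma transversal_subset: "transversals b c Y \<tau> \<Longrightarrow> y \<in> Y \<Longrightarrow> \<tau> y \<subseteq> {0..<1+b+c}"
  by (elim transversal_tripleE) auto

lemma wyes_edge_new:
  assumes t: "transversals b c Y \<tau>" and y: "y \<in> Y"
  shows "{y, u} \<in> edges (wyes (complete_tripartite 1 b c) Y \<tau>) \<longleftrightarrow> u \<in> \<tau> y"
proof -
  have yV: "y \<notin> {0..<1+b+c}" using t y by (auto simp: transversals_def)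
  then have "{y, u} \<notin> edges (complete_tripartite 1 b c)" by (simp add: edge_complete_tripartite)
  then have "{y, u} \<in> edges (wyes (complete_tripartite 1 b c) Y \<tau>) \<longleftrightarrow>
      (\<exists>y'\<in>Y. \<exists>s\<in>\<tau> y'. {y, u} = {s, y'})" by (simp add: wyes_def image_iff)
  moreover have "{y, u} = {s, y'} \<longleftrightarrow> y = y' \<and> u = s" if "y' \<in> Y" "s \<in> \<tau> y'" for y' s
    using transversal_subset[OF t that(1)] that(2) yV by (auto simp: doubleton_eq_iff)
  ultimately show ?thesis using y by metis
qed

lemma wyes_edge_old:
  assumes t: "transversals b c Y \<tau>" and p: "p \<notin> Y" "q \<notin> Y"
  shows "{p, q} \<in> edges (wyes (complete_tripartite 1 b c) Y \<tau>) \<longleftrightarrow>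
    {p, q} \<in> edges (complete_tripartite 1 b c) \<and> (\<forall>y\<in>Y. \<not> {p, q} \<subseteq> \<tau> y)"
proof -
  have "{p, q} \<notin> (\<lambda>s. {s, y}) ` \<tau> y" if "y \<in> Y" for y
    using that p by (auto simp: doubleton_eq_iff)
  moreover have "p \<noteq> q" if "{p, q} \<in> edges (complete_tripartite 1 b c)"
    using that by (auto simp: edge_complete_tripartite)
  ultimately show ?thesis unfolding wyes_def snd_conv by (auto simp: in_pairs_iff)
qed

text \<open>The neighbours of a new vertex are the corners of a former triangle whose sides were all
  removed. The conclusion names one corner only; rotating the hypotheses gives the others.\<close>

lemma wyes_no_new_triangle:
  assumes t: "transversals b c Y \<tau>"
    and e: "{x, y} \<in> edges (wyes (complete_tripartite 1 b c) Y \<tau>)"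
      "{y, z} \<in> edges (wyes (complete_tripartite 1 b c) Y \<tau>)"
      "{z, x} \<in> edges (wyes (complete_tripartite 1 b c) Y \<tau>)"
  shows "x \<notin> Y"
proof
  assume x: "x \<in> Y"
  then have "y \<in> \<tau> x" "z \<in> \<tau> x"
    using e wyes_edge_new[OF t x] by (metis insert_commute)+
  moreover from this have "y \<notin> Y" "z \<notin> Y"
    using transversal_subset[OF t x] t by (auto simp: transversals_def)
  ultimately show False using e(2) wyes_edge_old[OF t] x by blast
qed

text \<open>A triangle consists of old vertices, one from each part, hence contains
  \<open>0\<close>. It shares no other corner with an earlier triangle, as the edge from
  \<open>0\<close> to that corner is gone.\<close>

lemma wyes_triangle_Y:
  assumes t: "transversals b c Y \<tau>" and m: "triangle_Y (wyes (complete_tripartite 1 b c) Y \<tau>) H"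
  shows "\<exists>Y' \<tau>'. transversals b c Y' \<tau>' \<and> H = wyes (complete_tripartite 1 b c) Y' \<tau>'"
proof -
  let ?K = "complete_tripartite 1 b c" and ?V = "{0..<1+b+c}"
  let ?G = "wyes ?K Y \<tau>"
  obtain x y z v where e: "{x, y} \<in> edges ?G" "{y, z} \<in> edges ?G" "{z, x} \<in> edges ?G"
    and v: "v \<notin> verts ?G"
    and H: "H = (insert v (verts ?G), (edges ?G - {{x, y}, {y, z}, {z, x}}) \<union> {{x, v}, {y, v}, {z, v}})"
    using m by (auto simp: triangle_Y_def)
  have n: "x \<notin> Y" "y \<notin> Y" "z \<notin> Y"
    using wyes_no_new_triangle[OF t e] wyes_no_new_triangle[OF t e(2,3,1)]
      wyes_no_new_triangle[OF t e(3,1,2)] by auto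
  have eK: "{x, y} \<in> edges ?K" "{y, z} \<in> edges ?K" "{z, x} \<in> edges ?K"
    using e wyes_edge_old[OF t] n by blast+
  define T where "T = {x, y, z}"
  have TV: "T \<subseteq> ?V" and parts: "part 1 b x \<noteq> part 1 b y" "part 1 b y \<noteq> part 1 b z"
      "part 1 b z \<noteq> part 1 b x"
    using eK by (auto simp: edge_complete_tripartite T_def)
  have T0: "\<exists>p\<in>{1..<1+b}. \<exists>q\<in>{1+b..<1+b+c}. T = {0, p, q}"
  proof -
    have key: ?thesis if "part 1 b i = 0" "part 1 b j = 1" "part 1 b k = 2" "{x, y, z} = {i, j, k}" for i j k
    proof -
      have T: "T = {i, j, k}" unfolding T_def by (rule that(4))
      have "i = 0" "j \<in> {1..<1+b}" using that(1,2) by (auto simp: part_def split: if_splits)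
      moreover have "k < 1 + b + c" using T TV by auto
      then have "k \<in> {1+b..<1+b+c}" using that(3) by (auto simp: part_def split: if_splits)
      ultimately show ?thesis using T by blast
    qed
    have "part 1 b u = 0 \<or> part 1 b u = 1 \<or> part 1 b u = 2" for u by (simp add: part_def)
    then consider "part 1 b x = 0 \<and> part 1 b y = 1 \<and> part 1 b z = 2"
      | "part 1 b x = 0 \<and> part 1 b z = 1 \<and> part 1 b y = 2"
      | "part 1 b y = 0 \<and> part 1 b x = 1 \<and> part 1 b z = 2"
      | "part 1 b y = 0 \<and> part 1 b z = 1 \<and> part 1 b x = 2"
      | "part 1 b z = 0 \<and> part 1 b x = 1 \<and> part 1 b y = 2"
      | "part 1 b z = 0 \<and> part 1 b y = 1 \<and> part 1 b x = 2"
      using parts by metis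
    then show ?thesis
      by cases (elim conjE, rule key, assumption, assumption, assumption, blast)+
  qed
  have ne: "x \<noteq> y" "y \<noteq> z" "z \<noteq> x" using parts by auto
  have pT: "pairs T \<subseteq> edges ?G" using e ne by (simp add: T_def pairs_triple)
  have disj: "T \<inter> \<tau> w = {0}" if w: "w \<in> Y" for w
  proof -
    have 0: "0 \<in> T" "0 \<in> \<tau> w" using T0 t w by (auto simp: transversals_def)
    have "u = 0" if u: "u \<in> T" "u \<in> \<tau> w" for u
    proof (rule ccontr)
      assume "u \<noteq> 0"
      then have "{0, u} \<in> edges ?G" using pT 0 u in_pairs_iff[of 0 u T] by blast
      moreover have "0 \<notin> Y" "u \<notin> Y" using u n t 0 by (auto simp: T_def transversals_def)
      ultimately show False using wyes_edge_old[OF t] 0 u w by blast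
    qed
    then show ?thesis using 0 by blast
  qed
  have vY: "v \<notin> Y" "v \<notin> ?V" using v by (auto simp: wyes_def)
  let ?\<tau> = "\<tau>(v := T)"
  have \<tau>: "?\<tau> w = \<tau> w" if "w \<in> Y" for w using that vY by auto
  have "transversals b c (insert v Y) ?\<tau>"
    using t vY T0 disj unfolding transversals_def by (simp add: Int_commute)
  moreover have "H = wyes ?K (insert v Y) ?\<tau>"
  proof -
    have *: "A - P \<union> Q - P' \<union> Q' = A - (P' \<union> P) \<union> (Q' \<union> Q)" if "Q \<inter> P' = {}" for A P Q P' Q' :: "nat set set"
      using that by blast
    have "(\<Union>w\<in>Y. (\<lambda>s. {s, w}) ` \<tau> w) \<inter> pairs T = {}"
      using n by (auto simp: T_def pairs_def doubleton_eq_iff)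
    from *[OF this, of "edges ?K" "\<Union>w\<in>Y. pairs (\<tau> w)" "(\<lambda>s. {s, v}) ` T"]
    have "edges H = edges (wyes ?K (insert v Y) ?\<tau>)"
      using \<tau> pairs_triple[OF ne] by (simp add: H wyes_def T_def)
    then show ?thesis by (simp add: H wyes_def prod_eq_iff)
  qed
  ultimately show ?thesis by blast
qed

text \<open>The degree hypothesis leaves only the new vertices for removal, so the move undoes one
  of the Triangle-Y moves.\<close>

lemma wyes_Y_triangle:
  assumes t: "transversals b c Y \<tau>" and m: "Y_triangle (wyes (complete_tripartite 1 b c) Y \<tau>) H"
    and deg: "\<And>v. v \<in> {0..<1+b+c} \<Longrightarrow> 4 \<le> card (neighbours (wyes (complete_tripartite 1 b c) Y \<tau>) v)"
  shows "\<exists>Y' \<tau>'. transversals b c Y' \<tau>' \<and> H = wyes (complete_tripartite 1 b c) Y' \<tau>'"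
proof -
  let ?K = "complete_tripartite 1 b c" and ?V = "{0..<1+b+c}"
  let ?G = "wyes ?K Y \<tau>"
  obtain x y z v where v: "v \<in> verts ?G" and N: "neighbours ?G v = {x, y, z}" "card {x, y, z} = 3"
    and H: "H = (verts ?G - {v}, (edges ?G - {{x, v}, {y, v}, {z, v}}) \<union> {{x, y}, {y, z}, {z, x}})"
    using m by (auto simp: Y_triangle_def)
  have vV: "v \<notin> ?V" using deg N by fastforce
  then have vY: "v \<in> Y" using v by (auto simp: wyes_def)
  have xyz: "\<tau> v = {x, y, z}" using N wyes_edge_new[OF t vY] by (auto simp: neighbours_def)
  have ne: "x \<noteq> y" "y \<noteq> z" "z \<noteq> x" using N(2) by (auto simp: card_insert_if split: if_splits)
  let ?Y = "Y - {v}"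
  have "transversals b c ?Y \<tau>" using t unfolding transversals_def by blast
  moreover have "H = wyes ?K ?Y \<tau>"
  proof -
    have *: "A - (P' \<union> P) \<union> (Q' \<union> Q) - Q' \<union> P' = A - P \<union> Q"
      if "P' \<subseteq> A" "P' \<inter> P = {}" "Q \<inter> Q' = {}" "A \<inter> Q' = {}" for A P Q P' Q' :: "nat set set"
      using that by blast
    obtain p q where pq: "p \<in> {1..<1+b}" "q \<in> {1+b..<1+b+c}" "\<tau> v = {0, p, q}"
      using transversal_tripleE[OF t vY] .
    have 1: "pairs (\<tau> v) \<subseteq> edges ?K"
      using pq by (auto simp: pairs_triple edge_complete_tripartite part_def)
    have 2: "pairs (\<tau> v) \<inter> (\<Union>w\<in>?Y. pairs (\<tau> w)) = {}"
    proof (rule ccontr)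
      assume "\<not> ?thesis"
      then obtain w e where w: "w \<in> Y" "w \<noteq> v" "e \<in> pairs (\<tau> v)" "e \<in> pairs (\<tau> w)" by blast
      then obtain i j where ij: "e = {i, j}" "i \<noteq> j" by (auto simp: pairs_def)
      then have "{i, j} \<subseteq> \<tau> v \<inter> \<tau> w" using w by (auto simp: in_pairs_iff)
      moreover have "\<tau> v \<inter> \<tau> w = {0}" using transversal_disjoint[OF t vY w(1)] w(2) by simp
      ultimately show False using ij by auto
    qed
    have 3: "(\<Union>w\<in>?Y. (\<lambda>s. {s, w}) ` \<tau> w) \<inter> (\<lambda>s. {s, v}) ` \<tau> v = {}"
      using transversal_subset[OF t] vV by (fastforce simp: doubleton_eq_iff)
    have 4: "edges ?K \<inter> (\<lambda>s. {s, v}) ` \<tau> v = {}"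
      using vV by (auto simp: edge_complete_tripartite)
    have U: "(\<Union>w\<in>Y. F w) = F v \<union> (\<Union>w\<in>?Y. F w)" for F :: "nat \<Rightarrow> nat set set"
      using vY by blast
    have "edges H = edges (wyes ?K ?Y \<tau>)"
      using *[OF 1 2 3 4] unfolding H wyes_def snd_conv U xyz pairs_triple[OF ne] by simp
    moreover have "verts H = verts (wyes ?K ?Y \<tau>)" using vV by (auto simp: H wyes_def)
    ultimately show ?thesis by (simp add: prod_eq_iff)
  qed
  ultimately show ?thesis by blast
qed

text \<open>\<open>A \<union> B\<close> and \<open>A \<union> C\<close> both remain frames, with
  \<open>c\<close> and \<open>b\<close> bridges. Every original vertex lies in one of them and so
  keeps degree at least four.\<close>

lemma moves_wyes:
  assumes "move\<^sup>*\<^sup>* (complete_tripartite 1 b c) G" and bc: "4 \<le> b" "4 \<le> c"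
  shows "\<exists>Y \<tau>. transversals b c Y \<tau> \<and> G = wyes (complete_tripartite 1 b c) Y \<tau>"
proof -
  let ?K = "complete_tripartite 1 b c"
  let ?S' = "insert 0 {1+b..<1+b+c}"
  have B: "{i \<in> {0..<1+b+c}. part 1 b i = 1} = {1..<1+b}" by (auto simp: part_def split: if_splits)
  have S': "{0..<1+b+c} - {1..<1+b} = ?S'" by auto
  have F': "frame (1 + c) b ?K ?S'"
    using frame_complete_tripartite[of 1 b c 1] unfolding B S' by simp
  have "frame (1 + b) c ?K {0..<1+b}" by (rule frame_AB)
  with assms(1) F' have "(\<exists>Y \<tau>. transversals b c Y \<tau> \<and> G = wyes ?K Y \<tau>) \<and>
      frame (1 + b) c G {0..<1+b} \<and> frame (1 + c) b G ?S'"
  proof (induction rule: rtranclp_induct)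
    case base
    have "transversals b c {} \<tau> \<and> ?K = wyes ?K {} \<tau>" for \<tau>
      by (simp add: transversals_def wyes_def prod_eq_iff)
    then show ?case using base by blast
  next
    case (step G H)
    then obtain Y \<tau> where t: "transversals b c Y \<tau>" "G = wyes ?K Y \<tau>"
      and F: "frame (1 + b) c G {0..<1+b}" "frame (1 + c) b G ?S'" by blast
    have "4 \<le> card (neighbours G v)" if "v \<in> {0..<1+b+c}" for v
    proof (cases "v < 1 + b")
      case True
      then show ?thesis using frame_degree[OF F(1), of v] bc by simp
    next
      case False
      then show ?thesis using frame_degree[OF F(2), of v] bc that by simp
    qed
    then have "\<exists>Y \<tau>. transversals b c Y \<tau> \<and> H = wyes ?K Y \<tau>"
      using step.hyps(2) wyes_triangle_Y[OF t(1)] wyes_Y_triangle[OF t(1)] t(2) by metis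
    moreover have "frame (1 + b) c H {0..<1+b}" "frame (1 + c) b H ?S'"
      using frame_move[OF F(1) step.hyps(2)] frame_move[OF F(2) step.hyps(2)] bc by auto
    ultimately show ?case by blast
  qed
  then show ?thesis by blast
qed

text \<open>The images of \<open>f\<close> and \<open>g\<close> have equal size, hence so do their
  complements in \<open>B\<close>, and any bijection between these completes the map.\<close>

lemma extend_injections:
  assumes "finite B" "inj_on f Y" "f ` Y \<subseteq> B" "inj_on g Y" "g ` Y \<subseteq> B"
  obtains \<pi> where "bij_betw \<pi> B B" "\<And>y. y \<in> Y \<Longrightarrow> \<pi> (f y) = g y"
proof -
  have "card (f ` Y) = card (g ` Y)" using assms(2,4) by (simp add: card_image)
  then have "card (B - f ` Y) = card (B - g ` Y)"
    using assms by (simp add: card_Diff_subset finite_subset)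
  then obtain k where k: "bij_betw k (B - f ` Y) (B - g ` Y)"
    using finite_same_card_bij assms(1) by blast
  define \<pi> where "\<pi> u = (if u \<in> f ` Y then g (inv_into Y f u) else k u)" for u
  have \<pi>f: "\<pi> (f y) = g y" if "y \<in> Y" for y using that assms(2) by (simp add: \<pi>_def)
  then have "\<pi> ` f ` Y = g ` Y" by force
  moreover have "inj_on \<pi> (f ` Y)"
    using \<pi>f assms(4) by (auto simp: inj_on_def)
  ultimately have "bij_betw \<pi> (f ` Y) (g ` Y)" by (simp add: bij_betw_def)
  moreover have "bij_betw \<pi> (B - f ` Y) (B - g ` Y)"
    using k by (rule bij_betw_cong[THEN iffD1, rotated]) (simp add: \<pi>_def)
  ultimately have "bij_betw \<pi> (f ` Y \<union> (B - f ` Y)) (g ` Y \<union> (B - g ` Y))"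
    by (rule bij_betw_combine) auto
  then have "bij_betw \<pi> B B" using assms(3,5) by (simp add: Un_absorb1)
  then show ?thesis using that \<pi>f by blast
qed

lemma transversalsE:
  assumes t: "transversals b c Y \<tau>"
  obtains \<beta> \<gamma> where "inj_on \<beta> Y" "\<beta> ` Y \<subseteq> {1..<1+b}" "inj_on \<gamma> Y" "\<gamma> ` Y \<subseteq> {1+b..<1+b+c}"
    "\<forall>y\<in>Y. \<tau> y = {0, \<beta> y, \<gamma> y}"
proof -
  have "\<exists>p q. p \<in> {1..<1+b} \<and> q \<in> {1+b..<1+b+c} \<and> \<tau> y = {0, p, q}" if "y \<in> Y" for y
    using transversal_tripleE[OF t that] by metis
  then obtain \<beta> \<gamma> where bg: "\<And>y. y \<in> Y \<Longrightarrow> \<beta> y \<in> {1..<1+b} \<and> \<gamma> y \<in> {1+b..<1+b+c} \<and> \<tau> y = {0, \<beta> y, \<gamma> y}"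
    by metis
  have disj: "\<tau> y \<inter> \<tau> y' = {0}" if "y \<in> Y" "y' \<in> Y" "y \<noteq> y'" for y y'
    using transversal_disjoint[OF t that] .
  have "inj_on \<beta> Y"
  proof (rule inj_onI, rule ccontr)
    fix y y' assume y: "y \<in> Y" "y' \<in> Y" "\<beta> y = \<beta> y'" "y \<noteq> y'"
    then have "\<beta> y \<in> \<tau> y \<inter> \<tau> y'" using bg by simp
    then have "\<beta> y = 0" unfolding disj[OF y(1,2,4)] by simp
    then show False using bg[OF y(1)] by simp
  qed
  moreover have "inj_on \<gamma> Y"
  proof (rule inj_onI, rule ccontr)
    fix y y' assume y: "y \<in> Y" "y' \<in> Y" "\<gamma> y = \<gamma> y'" "y \<noteq> y'"
    then have "\<gamma> y \<in> \<tau> y \<inter> \<tau> y'" using bg by simp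
    then have "\<gamma> y = 0" unfolding disj[OF y(1,2,4)] by simp
    then show False using bg[OF y(1)] by simp
  qed
  ultimately show ?thesis using that[of \<beta> \<gamma>] bg by blast
qed

text \<open>The triangles define matchings between \<open>B\<close> and \<open>C\<close>. Matchings
  of equal size are carried to each other by permutations of \<open>B\<close> and of
  \<open>C\<close>, which preserve the complete tripartite graph.\<close>

lemma wyes_iso:
  assumes t: "transversals b c Y \<tau>" and t': "transversals b c Y' \<tau>'" and card: "card Y = card Y'"
  shows "graph_iso (wyes (complete_tripartite 1 b c) Y \<tau>) (wyes (complete_tripartite 1 b c) Y' \<tau>')"
proof -
  let ?K = "complete_tripartite 1 b c" and ?V = "{0..<1+b+c}"
  let ?B = "{1..<1+b}" and ?C = "{1+b..<1+b+c}"
  obtain \<beta> \<gamma> where bg: "inj_on \<beta> Y" "\<beta> ` Y \<subseteq> ?B" "inj_on \<gamma> Y" "\<gamma> ` Y \<subseteq> ?C"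
    "\<forall>y\<in>Y. \<tau> y = {0, \<beta> y, \<gamma> y}" using transversalsE[OF t] .
  obtain \<beta>' \<gamma>' where bg': "inj_on \<beta>' Y'" "\<beta>' ` Y' \<subseteq> ?B" "inj_on \<gamma>' Y'" "\<gamma>' ` Y' \<subseteq> ?C"
    "\<forall>y\<in>Y'. \<tau>' y = {0, \<beta>' y, \<gamma>' y}" using transversalsE[OF t'] .
  have fY: "finite Y" "finite Y'" "Y \<inter> ?V = {}" "Y' \<inter> ?V = {}"
    using t t' by (auto simp: transversals_def)
  obtain g where g: "bij_betw g Y Y'" using finite_same_card_bij[OF fY(1,2) card] by blast
  then have gY: "g ` Y = Y'" and gi: "inj_on g Y" by (auto simp: bij_betw_def)
  have "inj_on (\<beta>' \<circ> g) Y" "(\<beta>' \<circ> g) ` Y \<subseteq> ?B"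
    using gi bg'(1,2) gY by (auto intro: comp_inj_on)
  then obtain \<pi> where \<pi>: "bij_betw \<pi> ?B ?B" "\<And>y. y \<in> Y \<Longrightarrow> \<pi> (\<beta> y) = (\<beta>' \<circ> g) y"
    using extend_injections[OF _ bg(1,2)] by (metis finite_atLeastLessThan)
  have "inj_on (\<gamma>' \<circ> g) Y" "(\<gamma>' \<circ> g) ` Y \<subseteq> ?C"
    using gi bg'(3,4) gY by (auto intro: comp_inj_on)
  then obtain \<rho> where \<rho>: "bij_betw \<rho> ?C ?C" "\<And>y. y \<in> Y \<Longrightarrow> \<rho> (\<gamma> y) = (\<gamma>' \<circ> g) y"
    using extend_injections[OF _ bg(3,4)] by (metis finite_atLeastLessThan)
  \<comment> \<open>The cases follow \<open>A\<close>, \<open>B\<close>, \<open>C\<close> and the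
    new vertices, which are never below \<open>1 + b + c\<close>.\<close>
  define h where "h u = (if u = 0 then 0 else if u < 1 + b then \<pi> u else if u < 1 + b + c then \<rho> u else g u)" for u
  have hB: "bij_betw h ?B ?B"
    using \<pi>(1) by (rule bij_betw_cong[THEN iffD1, rotated]) (auto simp: h_def)
  have hC: "bij_betw h ?C ?C"
    using \<rho>(1) by (rule bij_betw_cong[THEN iffD1, rotated]) (auto simp: h_def)
  have h0: "bij_betw h {0} {0}" by (simp add: bij_betw_def h_def)
  have hg: "h y = g y" if "y \<in> Y" for y
  proof -
    have "y \<notin> ?V" using that fY(3) by blast
    then show ?thesis by (auto simp: h_def)
  qed
  have hY: "bij_betw h Y Y'"
    using g by (rule bij_betw_cong[THEN iffD1, rotated]) (simp add: hg)
  have V: "?V = {0} \<union> (?B \<union> ?C)" by auto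
  have "bij_betw h (?B \<union> ?C) (?B \<union> ?C)" by (rule bij_betw_combine[OF hB hC]) auto
  then have hV: "bij_betw h ?V ?V" unfolding V by (rule bij_betw_combine[OF h0]) auto
  have all: "bij_betw h (?V \<union> Y) (?V \<union> Y')"
    using fY(4) by (intro bij_betw_combine[OF hV hY]) blast
  have inj: "inj_on h (?V \<union> Y)" using all by (simp add: bij_betw_def)
  have part: "part 1 b (h u) = part 1 b u" if "u \<in> ?V" for u
  proof -
    have "u \<in> ?B \<Longrightarrow> h u \<in> ?B" "u \<in> ?C \<Longrightarrow> h u \<in> ?C" "h 0 = 0"
      using hB hC by (auto simp: bij_betw_def h_def)
    then show ?thesis using that V by (cases "u = 0"; cases "u \<in> ?B") (auto simp: part_def)
  qed
  have \<tau>h: "h ` \<tau> y = \<tau>' (h y)" if y: "y \<in> Y" for y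
  proof -
    have b: "\<beta> y \<in> ?B" "\<gamma> y \<in> ?C" using bg(2,4) y by auto
    then have "h (\<beta> y) = \<pi> (\<beta> y)" "h (\<gamma> y) = \<rho> (\<gamma> y)" "h 0 = 0" by (auto simp: h_def)
    moreover have "g y \<in> Y'" using gY y by blast
    ultimately show ?thesis using bspec[OF bg(5) y] bg'(5) \<pi>(2)[OF y] \<rho>(2)[OF y] hg[OF y] by simp
  qed
  have sub: "\<tau> y \<subseteq> ?V" if "y \<in> Y" for y using transversal_subset[OF t that] .
  have pairs_image: "(`) h ` pairs T = pairs (h ` T)" if "T \<subseteq> ?V" for T
  proof -
    have i: "inj_on h T" using inj that by (auto intro: inj_on_subset)
    show ?thesis
    proof (intro set_eqI iffI)
      fix e assume "e \<in> (`) h ` pairs T"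
      then obtain p q where "p \<in> T" "q \<in> T" "p \<noteq> q" "e = {h p, h q}" by (auto simp: pairs_def)
      then show "e \<in> pairs (h ` T)" using i by (auto simp: in_pairs_iff inj_on_eq_iff)
    next
      fix e assume "e \<in> pairs (h ` T)"
      then obtain p q where pq: "p \<in> T" "q \<in> T" "p \<noteq> q" "e = h ` {p, q}" by (auto simp: pairs_def)
      then have "{p, q} \<in> pairs T" by (simp add: in_pairs_iff)
      then show "e \<in> (`) h ` pairs T" using pq(4) by blast
    qed
  qed
  have K: "(`) h ` edges ?K = edges ?K"
  proof (intro set_eqI iffI)
    fix e assume "e \<in> (`) h ` edges ?K"
    then obtain d where d: "d \<in> edges ?K" "e = h ` d" by blast
    then obtain p q where pq: "d = {p, q}" by (auto simp: complete_tripartite_def)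
    have "p \<in> ?V" "q \<in> ?V" using d pq by (auto simp: edge_complete_tripartite)
    moreover from this have "h p \<in> ?V" "h q \<in> ?V" using hV by (auto simp: bij_betw_def)
    ultimately have "{h p, h q} \<in> edges ?K"
      using d(1) part unfolding pq edge_complete_tripartite by simp
    then show "e \<in> edges ?K" using d pq by simp
  next
    fix e assume e: "e \<in> edges ?K"
    then obtain p q where pq: "e = {p, q}" by (auto simp: complete_tripartite_def)
    have "p \<in> h ` ?V" "q \<in> h ` ?V"
      using e pq hV by (auto simp: edge_complete_tripartite bij_betw_def)
    then obtain p' q' where p': "p' \<in> ?V" "q' \<in> ?V" "p = h p'" "q = h q'" by blast
    then have "{p', q'} \<in> edges ?K" using e part unfolding pq edge_complete_tripartite by simp
    moreover have "e = h ` {p', q'}" using pq p' by simp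
    ultimately show "e \<in> (`) h ` edges ?K" by blast
  qed
  have inj2: "inj_on ((`) h) (Pow ?V)"
    by (rule inj_on_image_Pow) (use hV in \<open>simp add: bij_betw_def\<close>)
  have "(`) h ` (edges ?K - (\<Union>y\<in>Y. pairs (\<tau> y))) = (`) h ` edges ?K - (`) h ` (\<Union>y\<in>Y. pairs (\<tau> y))"
  proof (rule inj_on_image_set_diff[OF inj2])
    show "edges ?K - (\<Union>y\<in>Y. pairs (\<tau> y)) \<subseteq> Pow ?V"
      using edge_subset[OF simple_complete_tripartite, of _ 1 b c] by auto
    show "(\<Union>y\<in>Y. pairs (\<tau> y)) \<subseteq> Pow ?V" using sub by (auto simp: pairs_def)
  qed
  also have "(`) h ` (\<Union>y\<in>Y. pairs (\<tau> y)) = (\<Union>y\<in>Y'. pairs (\<tau>' y))"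
  proof -
    have "(`) h ` (\<Union>y\<in>Y. pairs (\<tau> y)) = (\<Union>y\<in>Y. (`) h ` pairs (\<tau> y))" by (rule image_UN)
    also have "\<dots> = (\<Union>y\<in>Y. pairs (\<tau>' (h y)))" using pairs_image[OF sub] \<tau>h by simp
    also have "\<dots> = (\<Union>y\<in>h ` Y. pairs (\<tau>' y))" by simp
    also have "h ` Y = Y'" using hY by (simp add: bij_betw_def)
    finally show ?thesis .
  qed
  finally have 1: "(`) h ` (edges ?K - (\<Union>y\<in>Y. pairs (\<tau> y))) = edges ?K - (\<Union>y\<in>Y'. pairs (\<tau>' y))"
    using K by simp
  have "(`) h ` (\<Union>y\<in>Y. (\<lambda>s. {s, y}) ` \<tau> y) = (\<Union>y\<in>Y. (\<lambda>s. {s, h y}) ` h ` \<tau> y)"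
    by (simp add: image_UN image_image)
  also have "\<dots> = (\<Union>y\<in>Y. (\<lambda>s. {s, h y}) ` \<tau>' (h y))" using \<tau>h by simp
  also have "\<dots> = (\<Union>y\<in>h ` Y. (\<lambda>s. {s, y}) ` \<tau>' y)" by simp
  also have "h ` Y = Y'" using hY by (simp add: bij_betw_def)
  finally have 2: "(`) h ` (\<Union>y\<in>Y. (\<lambda>s. {s, y}) ` \<tau> y) = (\<Union>y\<in>Y'. (\<lambda>s. {s, y}) ` \<tau>' y)" .
  have "edges (wyes ?K Y' \<tau>') = (`) h ` edges (wyes ?K Y \<tau>)"
    unfolding wyes_def snd_conv image_Un 1 2 ..
  then show ?thesis using all unfolding graph_iso_def by (auto simp: wyes_def)
qed

text \<open>The vertex count reveals the number \<open>card Y\<close> of triangles replaced, and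
  this number determines the isomorphism type.\<close>

lemma cousins_complete_tripartite_1_iso:
  assumes bc: "4 \<le> b" "4 \<le> c"
    and G: "cousin (complete_tripartite 1 b c) G" and H: "cousin (complete_tripartite 1 b c) H"
    and card: "card (verts G) = card (verts H)"
  shows "graph_iso G H"
proof -
  let ?K = "complete_tripartite 1 b c"
  have *: "\<exists>Y \<tau>. transversals b c Y \<tau> \<and> graph_iso (wyes ?K Y \<tau>) A \<and> simple_graph (wyes ?K Y \<tau>) \<and>
      card (verts A) = 1 + b + c + card Y" if A: "cousin ?K A" for A
  proof -
    obtain A' where A': "move\<^sup>*\<^sup>* ?K A'" "graph_iso A' A" using A by (auto simp: cousin_def)
    have s: "simple_graph A'" using moves_simple[OF A'(1) simple_complete_tripartite] .
    obtain Y \<tau> where t: "transversals b c Y \<tau>" "A' = wyes ?K Y \<tau>"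
      using moves_wyes[OF A'(1) bc] by blast
    have "card (verts A') = card {0..<1+b+c} + card Y"
      unfolding t(2) wyes_def fst_conv verts_complete_tripartite
      using t(1) by (intro card_Un_disjoint) (auto simp: transversals_def)
    then have "card (verts A) = 1 + b + c + card Y" using graph_iso_card(1)[OF s A'(2)] by simp
    then show ?thesis using t A'(2) s by blast
  qed
  obtain Y \<tau> where 1: "transversals b c Y \<tau>" "graph_iso (wyes ?K Y \<tau>) G"
    "simple_graph (wyes ?K Y \<tau>)" "card (verts G) = 1 + b + c + card Y" using *[OF G] by blast
  obtain Y' \<tau>' where 2: "transversals b c Y' \<tau>'" "graph_iso (wyes ?K Y' \<tau>') H"
    "card (verts H) = 1 + b + c + card Y'" using *[OF H] by blast
  have "graph_iso (wyes ?K Y \<tau>) (wyes ?K Y' \<tau>')"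
    using 1(4) 2(3) card by (intro wyes_iso[OF 1(1) 2(1)]) simp
  then show ?thesis using graph_iso_sym[OF 1(3,2)] 2(2) graph_iso_trans by metis
qed

section \<open>Induction on the size of the third part\<close>

theorem theorem2:
  fixes a b c d :: nat
  assumes "1 \<le> a" and "a \<le> b" and "b \<le> c"
    and "(a, b) \<noteq> (1, 2)"
    and "d = max 4 (a * b)" and "c \<ge> d"
  shows "card (family (complete_tripartite a b c)) = card (family (complete_tripartite a b d))"
  using assms(6)
proof (induction rule: dec_induct)
  case base
  then show ?case by simp
next
  case (step n)
  then have n: "4 \<le> n" "a * b \<le> n" using assms(5) by auto
  have "card (family (complete_tripartite a b n)) = card (family (complete_tripartite a b (Suc n)))"
  proof (rule card_family_Suc[OF assms(1,2,4) n])
    fix G H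
    \<comment> \<open>In the symmetric case \<open>n = b\<close> gives \<open>b \<ge> 4\<close>, so
      the cousins of the graph with third part of size \<open>Suc n\<close> are determined by their
      number of vertices.\<close>
    assume an: "a = 1" "n = b"
      and m: "marked_cousin {0..<a+b} (complete_tripartite a b (Suc n)) G"
        "marked_cousin {0..<a+b} (complete_tripartite a b (Suc n)) H"
      and cardV: "card (verts G) = card (verts H)"
    have "4 \<le> b" "4 \<le> Suc n" using n an by auto
    moreover have "cousin (complete_tripartite 1 b (Suc n)) G" "cousin (complete_tripartite 1 b (Suc n)) H"
      using m[THEN marked_cousin_cousin, OF simple_complete_tripartite] an by auto
    ultimately show "graph_iso G H" using cardV by (rule cousins_complete_tripartite_1_iso)
  qed
  then show ?case using step by simp
qed

end
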